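(* Let $A,B\in\mathbb{C}^{n\times n}$ with $A$ Lyapunov regular and $B\in\{A\}_{\mathbb{C}}''$. Write $A=PJ_AP^{-1}$ in Jordan form and $B=P\widetilde{B}P^{-1}$ with the notation $r$, $\lambda_j$, $n_{j,q}$, $k_j$, $t_{j,i}$ given in the context, and let $\mathbb{H}_{A,B}$ be the Hill-Pick matrix defined in the context. Then $$\mathbb{H}_{A,B}=\big[\mathbb{H}_{A,B}^{(i,j)}\big]_{i,j=1}^r,\qquad \mathbb{H}_{A,B}^{(i,j)}=\Big[f_{j,b-1}^{\,i,a-1}\Big]_{a=1,\dots,n_{i,1}}^{b=1,\dots,n_{j,1}}\in\mathbb{C}^{n_{i,1}\times n_{j,1}}$$ (with $a$ the row index and $b$ the column index), where for $j,a\in\{1,\dots,r\}$, $0\le i\le n_{j,1}-1$ and $0\le c\le n_{a,1}-1$, $$f_{j,i}^{\,a,c}=\sum_{d=0}^{c}\binom{d+i}{d}\frac{(-1)^{d+i}\,\overline{t}_{a,c-d}}{(\lambda_j+\overline{\lambda}_a)^{d+i+1}}+\sum_{l=0}^{i}\binom{c+i-l}{c}\frac{(-1)^{i-l+c}\,t_{j,l}}{(\lambda_j+\overline{\lambda}_a)^{c+i-l+1}}.$$ In particular, $B$ Lyapunov dominates $A$ if and only if the matrix $\mathbb{H}_{A,B}$ is positive semidefinite.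
   Context: $A\in\mathbb{C}^{n\times n}$ with eigenvalues $\mu_1,\dots,\mu_n$ is Lyapunov regular if $\mu_i+\overline{\mu}_j\ne0$ for all $i,j$. $B$ Lyapunov dominates $A$ if for every Hermitian $H\in\mathbb{C}^{n\times n}$: $HA+A^*H\ge 0$ implies $HB+B^*H\ge0$ (positive semidefinite). The bicommutant $\{A\}_{\mathbb{C}}''$ equals $\{p(A):p\in\mathbb{C}[x]\}$. Jordan notation. Let $\lambda_1,\dots,\lambda_r$ be the distinct eigenvalues of $A$. Then $A=PJ_AP^{-1}$ with $P$ invertible and $J_A=\bigoplus_{j=1}^r\bigoplus_{q=1}^{k_j}J_{n_{j,q}}(\lambda_j)$, with $n_{j,1}\ge n_{j,2}\ge\dots\ge n_{j,k_j}$ for each $j$, where $J_m(\lambda)=\lambda I_m+S_m$ and $S_m=[\delta_{i+1,j}]_{i,j=1}^m$ is the upper shift matrix. Since $B\in\{A\}_{\mathbb{C}}''$, we have $B=P\widetilde{B}P^{-1}$ with $\widetilde{B}=\bigoplus_{j=1}^r\bigoplus_{q=1}^{k_j}T_{j,q}$, $T_{j,q}=\sum_{i=0}^{n_{j,q}-1}t_{j,i}S_{n_{j,q}}^i$, where the scalars $t_{j,i}\in\mathbb{C}$ ($0\le i\le n_{j,1}-1$) do not depend on $q$. Hill-Pick matrix. Let $L_{J_A,\widetilde{B}}=\big(\widetilde{B}^T\otimes I_n+I_n\otimes\widetilde{B}^*\big)\big(J_A^T\otimes I_n+I_n\otimes J_A^*\big)^{-1}\in\mathbb{C}^{n^2\times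 n^2}$ (Kronecker products $X\otimes Y=[x_{ij}Y]$), viewed as an $n\times n$ block matrix with $n\times n$ blocks; this is the matrix of the linear map $\mathcal{L}_{\widetilde{B}}\mathcal{L}_{J_A}^{-1}$, $\mathcal{L}_Y(X)=XY+Y^*X$, with respect to column-stacking vectorization. Put $n_j=n_{j,1}+\dots+n_{j,k_j}$ and $p_j=n_1+\dots+n_{j-1}$ (so $p_1=0$). The Hill-Pick matrix $\mathbb{H}_{A,B}$ is the matrix of size $w\times w$, $w=n_{1,1}+\dots+n_{r,1}$, whose rows are indexed by pairs $(i,a)$ with $1\le i\le r$, $1\le a\le n_{i,1}$ (lexicographic order), whose columns are indexed likewise by pairs $(j,b)$, and whose $((i,a),(j,b))$ entry is the $(p_i+a,\,p_i+1)$ entry of the $(p_j+b,\,p_j+1)$ block of $L_{J_A,\widetilde{B}}$; the submatrix with fixed $i,j$ is $\mathbb{H}_{A,B}^{(i,j)}$. *)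

theory Defs
  imports
    "Jordan_Normal_Form.Schur_Decomposition"
    "Jordan_Normal_Form.Gauss_Jordan_Elimination"
    "Jordan_Normal_Form.Spectral_Radius"
    "Jordan_Normal_Form.DL_Submatrix"
begin

definition hermitian_mat :: "complex mat \<Rightarrow> bool" where
  "hermitian_mat H \<longleftrightarrow> square_mat H \<and> mat_adjoint H = H"

(* The order on complex numbers is the one of Complex_Order: 0 \<le> z says that z is real and
   non-negative. Note that (M v) \<bullet>c v = v^* M v. *)
definition psd_mat :: "complex mat \<Rightarrow> bool" where
  "psd_mat M \<longleftrightarrow> hermitian_mat M \<and>
     (\<forall>v \<in> carrier_vec (dim_row M). 0 \<le> (M *\<^sub>v v) \<bullet>c v)"

definition lyapunov_regular :: "complex mat \<Rightarrow> bool" where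
  "lyapunov_regular A \<longleftrightarrow>
     (\<forall>\<mu> \<nu>. eigenvalue A \<mu> \<longrightarrow> eigenvalue A \<nu> \<longrightarrow> \<mu> + cnj \<nu> \<noteq> 0)"

(* lyapunov_dominates B A: the matrix B Lyapunov dominates the matrix A. *)
definition lyapunov_dominates :: "complex mat \<Rightarrow> complex mat \<Rightarrow> bool" where
  "lyapunov_dominates B A \<longleftrightarrow>
     (\<forall>H \<in> carrier_mat (dim_row A) (dim_row A). hermitian_mat H \<longrightarrow>
        psd_mat (H * A + mat_adjoint A * H) \<longrightarrow> psd_mat (H * B + mat_adjoint B * H))"

definition commutant :: "nat \<Rightarrow> complex mat set \<Rightarrow> complex mat set" where
  "commutant n S = {X \<in> carrier_mat n n. \<forall>Y \<in> S. X * Y = Y * X}"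

(* For square A this coincides with the set of all polynomials in A. *)
definition bicommutant :: "complex mat \<Rightarrow> complex mat set" where
  "bicommutant A = commutant (dim_row A) (commutant (dim_row A) {A})"

(* Kronecker product [x_ij Y] *)
definition kron :: "complex mat \<Rightarrow> complex mat \<Rightarrow> complex mat" where
  "kron X Y = mat (dim_row X * dim_row Y) (dim_col X * dim_col Y)
     (\<lambda>(i, j). X $$ (i div dim_row Y, j div dim_col Y) * Y $$ (i mod dim_row Y, j mod dim_col Y))"

(* Jordan data. All indices start at 0: the distinct eigenvalues are lam j for j < r, the blocks
   belonging to lam j are those with index q < k j, and m j q is the size of the q-th one, so that
   m j 0 is the largest block size for lam j. Likewise t j i is the coefficient of the i-th power
   of the shift in the blocks belonging to lam j. *)

definition jordan_form ::
    "nat \<Rightarrow> (nat \<Rightarrow> nat) \<Rightarrow> (nat \<Rightarrow> nat \<Rightarrow> nat) \<Rightarrow> (nat \<Rightarrow> complex) \<Rightarrow> complex mat" where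
  "jordan_form r k m lam = jordan_matrix [(m j q, lam j). j \<leftarrow> [0..<r], q \<leftarrow> [0..<k j]]"

(* \<Sum>i<d. c i \<cdot> S^i for the upper shift matrix S = jordan_block d 0. The sum is taken entrywise, as
   matrices without a fixed dimension do not form an additive monoid. *)
definition shift_poly :: "nat \<Rightarrow> (nat \<Rightarrow> complex) \<Rightarrow> complex mat" where
  "shift_poly d c = mat d d (\<lambda>ab. \<Sum>i<d. c i * (jordan_block d 0 ^\<^sub>m i) $$ ab)"

definition shift_poly_form ::
    "nat \<Rightarrow> (nat \<Rightarrow> nat) \<Rightarrow> (nat \<Rightarrow> nat \<Rightarrow> nat) \<Rightarrow> (nat \<Rightarrow> nat \<Rightarrow> complex) \<Rightarrow> complex mat" where
  "shift_poly_form r k m t =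
     diag_block_mat [shift_poly (m j q) (t j). j \<leftarrow> [0..<r], q \<leftarrow> [0..<k j]]"

(* The matrix of X \<mapsto> X Y + Y^* X with respect to column-stacking vectorization *)
definition lyapunov_op_mat :: "complex mat \<Rightarrow> complex mat" where
  "lyapunov_op_mat Y =
     kron (transpose_mat Y) (1\<^sub>m (dim_row Y)) + kron (1\<^sub>m (dim_row Y)) (mat_adjoint Y)"

(* Only meaningful when lyapunov_op_mat J is invertible; mat_inverse returns an option. *)
definition L_mat :: "complex mat \<Rightarrow> complex mat \<Rightarrow> complex mat" where
  "L_mat J Bt = lyapunov_op_mat Bt * the (mat_inverse (lyapunov_op_mat J))"

(* The block in position (u, v) of a matrix partitioned into n x n blocks *)
definition nth_block :: "nat \<Rightarrow> complex mat \<Rightarrow> nat \<Rightarrow> nat \<Rightarrow> complex mat" where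
  "nth_block n L u v = mat n n (\<lambda>(x, y). L $$ (u * n + x, v * n + y))"

(* p_j, the position where the blocks of lam j start *)
definition block_start :: "(nat \<Rightarrow> nat) \<Rightarrow> (nat \<Rightarrow> nat \<Rightarrow> nat) \<Rightarrow> nat \<Rightarrow> nat" where
  "block_start k m j = (\<Sum>l<j. \<Sum>q<k l. m l q)"

(* The pairs (i, a) with i < r and a < m i 0 in lexicographic order; the u-th row (column) of the
   Hill-Pick matrix is labelled by the u-th pair. *)
definition hp_index :: "nat \<Rightarrow> (nat \<Rightarrow> nat \<Rightarrow> nat) \<Rightarrow> (nat \<times> nat) list" where
  "hp_index r m = [(i, a). i \<leftarrow> [0..<r], a \<leftarrow> [0..<m i 0]]"

definition hill_pick_mat ::
    "nat \<Rightarrow> (nat \<Rightarrow> nat) \<Rightarrow> (nat \<Rightarrow> nat \<Rightarrow> nat) \<Rightarrow> (nat \<Rightarrow> complex) \<Rightarrow> (nat \<Rightarrow> nat \<Rightarrow> complex) \<Rightarrow>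
     complex mat" where
  "hill_pick_mat r k m lam t =
     (let J = jordan_form r k m lam;
          L = L_mat J (shift_poly_form r k m t);
          p = block_start k m;
          ix = hp_index r m
      in mat (length ix) (length ix) (\<lambda>(u, v).
           let (i, a) = ix ! u; (j, b) = ix ! v
           in nth_block (dim_row J) L (p j + b) (p j) $$ (p i + a, p i)))"

(* The submatrix of the Hill-Pick matrix with rows labelled (i, _) and columns labelled (j, _) *)
definition hill_pick_block ::
    "nat \<Rightarrow> (nat \<Rightarrow> nat) \<Rightarrow> (nat \<Rightarrow> nat \<Rightarrow> nat) \<Rightarrow> (nat \<Rightarrow> complex) \<Rightarrow> (nat \<Rightarrow> nat \<Rightarrow> complex) \<Rightarrow>
     nat \<Rightarrow> nat \<Rightarrow> complex mat" where
  "hill_pick_block r k m lam t i j =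
     (let ix = hp_index r m in
      submatrix (hill_pick_mat r k m lam t)
        {u. u < length ix \<and> fst (ix ! u) = i} {v. v < length ix \<and> fst (ix ! v) = j})"

(* The block matrix [M i j] for i, j < r, where M i j has size m i 0 x m j 0 *)
definition assemble_blocks ::
    "nat \<Rightarrow> (nat \<Rightarrow> nat \<Rightarrow> nat) \<Rightarrow> (nat \<Rightarrow> nat \<Rightarrow> complex mat) \<Rightarrow> complex mat" where
  "assemble_blocks r m M =
     (let ix = hp_index r m
      in mat (length ix) (length ix) (\<lambda>(u, v).
           let (i, a) = ix ! u; (j, b) = ix ! v in M i j $$ (a, b)))"

(* hp_coeff lam t j i a c is f_{j,i}^{a,c}. *)
definition hp_coeff ::
    "(nat \<Rightarrow> complex) \<Rightarrow> (nat \<Rightarrow> nat \<Rightarrow> complex) \<Rightarrow> nat \<Rightarrow> nat \<Rightarrow> nat \<Rightarrow> nat \<Rightarrow> complex" where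
  "hp_coeff lam t j i a c =
     (\<Sum>d = 0..c. of_nat ((d + i) choose d) * ((- 1) ^ (d + i) * cnj (t a (c - d)))
         / (lam j + cnj (lam a)) ^ (d + i + 1))
   + (\<Sum>l = 0..i. of_nat ((c + i - l) choose c) * ((- 1) ^ (i - l + c) * t j l)
         / (lam j + cnj (lam a)) ^ (c + i - l + 1))"

end

theory Submission
  imports Defs
begin

text \<open>Put \<open>\<Phi> = L_B L_J\<^sup>-\<^sup>1\<close> where \<open>L_Y X = X Y + Y\<^sup>* X\<close>; domination says that \<open>\<Phi>\<close> is positive.
  The Taylor coefficients of \<open>1 / (\<mu> + x + y)\<close> at the origin solve \<open>L_J X = E\<close> for a matrix unit \<open>E\<close>
  at the starts of two largest Jordan blocks, which gives the entries of the Hill-Pick matrix.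
  If \<open>w\<close> is the sum of the unit vectors at the starts of the largest blocks, then
  \<open>\<Phi> (w w\<^sup>*)\<close> is the Hill-Pick matrix padded with zeros, so it is positive semidefinite whenever
  \<open>\<Phi>\<close> is positive. Conversely, \<open>w\<close> is cyclic for the commutant of \<open>J\<^sup>*\<close>: each vector \<open>v\<close> is \<open>C\<^sup>* w\<close>
  for a block Toeplitz matrix \<open>C\<close> commuting with \<open>J\<close> and \<open>B\<close>. Hence
  \<open>\<Phi> (v v\<^sup>*) = C\<^sup>* \<Phi> (w w\<^sup>*) C\<close>, and every positive semidefinite matrix is a sum of
  rank-one matrices \<open>v v\<^sup>*\<close>.\<close>

subsection \<open>Positive semidefinite matrices and the Lyapunov operator\<close>

lemma mat_adjoint_carrier [simp]:
  "A \<in> carrier_mat n m \<Longrightarrow> mat_adjoint A \<in> carrier_mat m n"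
  unfolding mat_adjoint_def by auto

lemma mat_adjoint_dim [simp]:
  "dim_row (mat_adjoint A) = dim_col A" "dim_col (mat_adjoint A) = dim_row A"
  unfolding mat_adjoint_def by auto

lemma mat_adjoint_index [simp]:
  "i < dim_col A \<Longrightarrow> j < dim_row A \<Longrightarrow> mat_adjoint A $$ (i, j) = conjugate (A $$ (j, i))"
  unfolding mat_adjoint_def by (simp add: mat_of_rows_index)

lemma mat_adjoint_adjoint [simp]: "mat_adjoint (mat_adjoint A) = A"
  by (rule eq_matI) auto

lemma mat_adjoint_add:
  "A \<in> carrier_mat n m \<Longrightarrow> B \<in> carrier_mat n m \<Longrightarrow>
    mat_adjoint (A + B) = mat_adjoint A + mat_adjoint B"
  by (rule eq_matI) (auto simp: conjugate_dist_add)

lemma mat_adjoint_one: "mat_adjoint (1\<^sub>m n) = (1\<^sub>m n :: complex mat)"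
  by (rule eq_matI) auto

lemma mat_adjoint_mult:
  fixes A B :: "complex mat"
  assumes "A \<in> carrier_mat n m" "B \<in> carrier_mat m l"
  shows "mat_adjoint (A * B) = mat_adjoint B * mat_adjoint A"
  by (rule eq_matI) (use assms in \<open>auto simp: scalar_prod_def intro!: sum.cong\<close>)

lemma mat_adjoint_cscalar_prod:
  fixes A :: "complex mat"
  assumes A: "A \<in> carrier_mat n m" and u: "u \<in> carrier_vec n" and v: "v \<in> carrier_vec m"
  shows "(mat_adjoint A *\<^sub>v u) \<bullet>c v = u \<bullet>c (A *\<^sub>v v)"
proof -
  have "(mat_adjoint A *\<^sub>v u) \<bullet>c v
      = (\<Sum>i<m. (\<Sum>j<n. cnj (A $$ (j, i)) * u $ j) * cnj (v $ i))"
    using assms by (auto simp: scalar_prod_def atLeast0LessThan intro!: sum.cong)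
  also have "\<dots> = (\<Sum>j<n. \<Sum>i<m. cnj (A $$ (j, i)) * u $ j * cnj (v $ i))"
    by (subst sum.swap) (simp add: sum_distrib_right)
  also have "\<dots> = u \<bullet>c (A *\<^sub>v v)"
    using assms by (auto simp: scalar_prod_def atLeast0LessThan sum_distrib_left mult_ac
      intro!: sum.cong)
  finally show ?thesis .
qed

lemma hermitian_mat_congruence:
  assumes H: "hermitian_mat H" "H \<in> carrier_mat n n" and C: "C \<in> carrier_mat n l"
  shows "hermitian_mat (mat_adjoint C * H * C)"
proof -
  note adj = mat_adjoint_carrier[OF C]
  have "mat_adjoint (mat_adjoint C * H * C) = mat_adjoint C * (mat_adjoint H * C)"
    by (simp add: mat_adjoint_mult[OF mult_carrier_mat[OF adj H(2)] C] mat_adjoint_mult[OF adj H(2)])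
  also have "\<dots> = mat_adjoint C * H * C"
    using H unfolding hermitian_mat_def by (simp add: assoc_mult_mat[OF adj H(2) C])
  finally show ?thesis
    using C unfolding hermitian_mat_def by auto
qed

lemma psd_mat_congruence:
  assumes M: "psd_mat M" "M \<in> carrier_mat n n" and C: "C \<in> carrier_mat n l"
  shows "psd_mat (mat_adjoint C * M * C)"
proof -
  note adj = mat_adjoint_carrier[OF C]
  have herm: "hermitian_mat (mat_adjoint C * M * C)"
    using M C by (intro hermitian_mat_congruence) (auto simp: psd_mat_def)
  have "0 \<le> ((mat_adjoint C * M * C) *\<^sub>v v) \<bullet>c v" if v: "v \<in> carrier_vec l" for v
  proof -
    have Cv: "C *\<^sub>v v \<in> carrier_vec n"
      using C v by simp
    have "(mat_adjoint C * M * C) *\<^sub>v v = mat_adjoint C *\<^sub>v (M *\<^sub>v (C *\<^sub>v v))"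
      using assoc_mult_mat_vec[OF mult_carrier_mat[OF adj M(2)] C v]
        assoc_mult_mat_vec[OF adj M(2) Cv] by simp
    then have "((mat_adjoint C * M * C) *\<^sub>v v) \<bullet>c v = (M *\<^sub>v (C *\<^sub>v v)) \<bullet>c (C *\<^sub>v v)"
      using mat_adjoint_cscalar_prod[OF C _ v] mult_mat_vec_carrier[OF M(2) Cv] by simp
    then show ?thesis
      using M Cv unfolding psd_mat_def by auto
  qed
  then show ?thesis
    using herm C unfolding psd_mat_def by auto
qed

lemma psd_mat_add:
  assumes "psd_mat M" "psd_mat N" "M \<in> carrier_mat n n" "N \<in> carrier_mat n n"
  shows "psd_mat (M + N)"
  using assms unfolding psd_mat_def hermitian_mat_def
  by (auto simp: mat_adjoint_add[OF assms(3,4)] add_mult_distrib_mat_vec[OF assms(3,4)]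
      add_scalar_prod_distrib[of _ n])

definition lyap :: "complex mat \<Rightarrow> complex mat \<Rightarrow> complex mat" where
  "lyap Y X = X * Y + mat_adjoint Y * X"

lemma lyap_carrier [simp]:
  "Y \<in> carrier_mat n n \<Longrightarrow> X \<in> carrier_mat n n \<Longrightarrow> lyap Y X \<in> carrier_mat n n"
  unfolding lyap_def by (simp add: mult_carrier_mat[of _ n n])

lemma lyap_zero: "Y \<in> carrier_mat n n \<Longrightarrow> lyap Y (0\<^sub>m n n) = 0\<^sub>m n n"
  using mat_adjoint_carrier[of Y n n] unfolding lyap_def by simp

lemma lyap_add:
  assumes "Y \<in> carrier_mat n n" "X \<in> carrier_mat n n" "X' \<in> carrier_mat n n"
  shows "lyap Y (X + X') = lyap Y X + lyap Y X'"
proof -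
  note adj = mat_adjoint_carrier[OF assms(1)]
  show ?thesis
    unfolding lyap_def add_mult_distrib_mat[OF assms(2,3,1)] mult_add_distrib_mat[OF adj assms(2,3)]
    by (rule eq_matI) (use assms in auto)
qed

lemma lyap_diff:
  assumes "Y \<in> carrier_mat n n" "X \<in> carrier_mat n n" "X' \<in> carrier_mat n n"
  shows "lyap Y (X - X') = lyap Y X - lyap Y X'"
proof -
  note adj = mat_adjoint_carrier[OF assms(1)]
  show ?thesis
    unfolding lyap_def minus_mult_distrib_mat[OF assms(2,3,1)] mult_minus_distrib_mat[OF adj assms(2,3)]
    by (rule eq_matI) (use assms in auto)
qed

text \<open>Pushing \<open>C\<close> through \<open>Y\<close> turns the right factor
  \<open>C * Z\<close> into \<open>Y * C\<close>, and the adjoint of the same identity treats the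
  left term. The lemma serves both for changing the basis and for matrices commuting with the Jordan
  form.\<close>

lemma lyap_congruence:
  assumes Y: "Y \<in> carrier_mat n n" and Z: "Z \<in> carrier_mat l l" and X: "X \<in> carrier_mat n n"
    and C: "C \<in> carrier_mat n l" and intertwine: "C * Z = Y * C"
  shows "lyap Z (mat_adjoint C * X * C) = mat_adjoint C * lyap Y X * C"
proof -
  note adjC = mat_adjoint_carrier[OF C] and adjY = mat_adjoint_carrier[OF Y]
    and adjZ = mat_adjoint_carrier[OF Z]
  note CX = mult_carrier_mat[OF adjC X]
  have "mat_adjoint C * X * C * Z = mat_adjoint C * X * (Y * C)"
    unfolding intertwine[symmetric] by (rule assoc_mult_mat[OF CX C Z])
  also have "\<dots> = mat_adjoint C * (X * Y) * C"
    using assoc_mult_mat[OF CX Y C] assoc_mult_mat[OF adjC X Y] by simp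
  finally have right: "mat_adjoint C * X * C * Z = mat_adjoint C * (X * Y) * C" .
  have "mat_adjoint Z * (mat_adjoint C * X * C) = mat_adjoint Z * mat_adjoint C * X * C"
    using assoc_mult_mat[OF adjZ CX C] assoc_mult_mat[OF adjZ adjC X] by simp
  also have "mat_adjoint Z * mat_adjoint C = mat_adjoint C * mat_adjoint Y"
    using mat_adjoint_mult[OF C Z] mat_adjoint_mult[OF Y C] intertwine by simp
  also have "mat_adjoint C * mat_adjoint Y * X = mat_adjoint C * (mat_adjoint Y * X)"
    by (rule assoc_mult_mat[OF adjC adjY X])
  finally have left: "mat_adjoint Z * (mat_adjoint C * X * C) = mat_adjoint C * (mat_adjoint Y * X) * C" .
  note XY = mult_carrier_mat[OF X Y] and YX = mult_carrier_mat[OF adjY X]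
  show ?thesis
    unfolding lyap_def left right mult_add_distrib_mat[OF adjC XY YX]
    by (rule add_mult_distrib_mat[OF mult_carrier_mat[OF adjC XY] mult_carrier_mat[OF adjC YX] C,
          symmetric])
qed

lemma lyapunov_dominates_iff_lyap:
  "lyapunov_dominates B A \<longleftrightarrow> (\<forall>H \<in> carrier_mat (dim_row A) (dim_row A). hermitian_mat H \<longrightarrow>
     psd_mat (lyap A H) \<longrightarrow> psd_mat (lyap B H))"
  unfolding lyapunov_dominates_def lyap_def ..

lemma similar_mat_wit_intertwine:
  assumes A: "A \<in> carrier_mat n n" and sim: "similar_mat_wit A A' P Q"
  shows "Q * A = A' * Q"
proof -
  note w = similar_mat_witD2[OF A sim]
  have "Q * A = Q * (P * (A' * Q))"
    using w(3) assoc_mult_mat[OF w(6,5,7)] by simp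
  also have "\<dots> = Q * P * (A' * Q)"
    by (rule assoc_mult_mat[symmetric, OF w(7,6) mult_carrier_mat[OF w(5,7)]])
  also have "\<dots> = A' * Q"
    unfolding w(2) by (rule left_mult_one_mat[OF mult_carrier_mat[OF w(5,7)]])
  finally show ?thesis .
qed

text \<open>Pull \<open>H\<close> back to \<open>Q^* H Q\<close>, use domination there, and return
  by congruence with \<open>P\<close>, since \<open>Q * P\<close> is the identity. One implication
  suffices, because reversing the similarity witness gives the other.\<close>

lemma lyapunov_dominates_similar:
  assumes A: "A \<in> carrier_mat n n" and B: "B \<in> carrier_mat n n"
    and simA: "similar_mat_wit A A' P Q" and simB: "similar_mat_wit B B' P Q"
    and dom: "lyapunov_dominates B A"
  shows "lyapunov_dominates B' A'"
proof -
  note wA = similar_mat_witD2[OF A simA] and wB = similar_mat_witD2[OF B simB]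
  have "psd_mat (lyap B' H)"
    if H: "H \<in> carrier_mat n n" "hermitian_mat H" "psd_mat (lyap A' H)" for H
  proof -
    let ?K = "mat_adjoint Q * H * Q"
    have K: "?K \<in> carrier_mat n n"
      by (rule mult_carrier_mat[OF mult_carrier_mat[OF mat_adjoint_carrier[OF wA(7)] H(1)] wA(7)])
    have "lyap A ?K = mat_adjoint Q * lyap A' H * Q"
      by (rule lyap_congruence[OF wA(5,4) H(1) wA(7) similar_mat_wit_intertwine[OF A simA]])
    then have "psd_mat (lyap A ?K)"
      using psd_mat_congruence[OF H(3) lyap_carrier[OF wA(5) H(1)] wA(7)] by simp
    then have dom_K: "psd_mat (lyap B ?K)"
      using dom K hermitian_mat_congruence[OF H(2,1) wA(7)] A
      unfolding lyapunov_dominates_iff_lyap by simp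
    have "mat_adjoint P * ?K * P = mat_adjoint (Q * P) * H * (Q * P)"
    proof -
      note adjP = mat_adjoint_carrier[OF wA(6)] and adjQ = mat_adjoint_carrier[OF wA(7)]
      have "mat_adjoint P * ?K * P = mat_adjoint P * (mat_adjoint Q * H) * (Q * P)"
        using assoc_mult_mat[OF adjP mult_carrier_mat[OF adjQ H(1)] wA(7)]
          assoc_mult_mat[OF mult_carrier_mat[OF adjP mult_carrier_mat[OF adjQ H(1)]] wA(7,6)]
        by simp
      also have "mat_adjoint P * (mat_adjoint Q * H) = mat_adjoint P * mat_adjoint Q * H"
        using assoc_mult_mat[OF adjP adjQ H(1)] by simp
      finally show ?thesis
        by (simp add: mat_adjoint_mult[OF wA(7,6)])
    qed
    also have "\<dots> = H"
      using H(1) unfolding wA(2) by (simp add: mat_adjoint_one)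
    finally have "lyap B' H = mat_adjoint P * lyap B ?K * P"
      using lyap_congruence[OF B wB(5) K wA(6)] similar_mat_wit_intertwine[OF wB(5)
          similar_mat_wit_sym[OF simB]] by simp
    then show ?thesis
      using psd_mat_congruence[OF dom_K lyap_carrier[OF B K] wA(6)] by simp
  qed
  then show ?thesis
    using wA(5) unfolding lyapunov_dominates_iff_lyap by simp
qed

section \<open>Quadratic forms and decomposition into rank-one matrices\<close>

definition hform :: "nat \<Rightarrow> complex mat \<Rightarrow> (nat \<Rightarrow> complex) \<Rightarrow> (nat \<Rightarrow> complex) \<Rightarrow> complex" where
  "hform n M u v = (\<Sum>i<n. \<Sum>j<n. cnj (u i) * M $$ (i, j) * v j)"

lemma hermitian_mat_iff:
  assumes "M \<in> carrier_mat n n"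
  shows "hermitian_mat M \<longleftrightarrow> (\<forall>i<n. \<forall>j<n. M $$ (i, j) = cnj (M $$ (j, i)))"
proof
  assume "hermitian_mat M"
  then have "M = mat_adjoint M"
    unfolding hermitian_mat_def by simp
  show "\<forall>i<n. \<forall>j<n. M $$ (i, j) = cnj (M $$ (j, i))"
    by (subst \<open>M = mat_adjoint M\<close>) (use assms in auto)
next
  assume *: "\<forall>i<n. \<forall>j<n. M $$ (i, j) = cnj (M $$ (j, i))"
  have "mat_adjoint M = M"
  proof (rule eq_matI)
    fix i j assume "i < dim_row M" "j < dim_col M"
    then have "i < n" "j < n"
      using assms by auto
    then show "mat_adjoint M $$ (i, j) = M $$ (i, j)"
      using *[rule_format, of i j] assms by simp
  qed (use assms in auto)
  then show "hermitian_mat M"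
    using assms unfolding hermitian_mat_def by simp
qed

text \<open>Test vectors become functions of which only the values below \<open>n\<close> matter, so
  the quantifier carries no carrier condition and unit vectors can be added by
  \<open>if\<close>.\<close>

lemma psd_mat_iff_hform:
  assumes "M \<in> carrier_mat n n"
  shows "psd_mat M \<longleftrightarrow>
    (\<forall>i<n. \<forall>j<n. M $$ (i, j) = cnj (M $$ (j, i))) \<and> (\<forall>v. 0 \<le> hform n M v v)"
proof -
  have *: "(M *\<^sub>v vec n v) \<bullet>c vec n v = hform n M v v" for v
    using assms by (auto simp: hform_def scalar_prod_def atLeast0LessThan sum_distrib_left
      mult_ac intro!: sum.cong)
  have "(\<forall>v \<in> carrier_vec n. 0 \<le> (M *\<^sub>v v) \<bullet>c v) \<longleftrightarrow> (\<forall>v. 0 \<le> hform n M v v)"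
  proof (intro iffI ballI allI)
    fix v :: "complex vec"
    assume "\<forall>v. 0 \<le> hform n M v v" "v \<in> carrier_vec n"
    moreover from this have "v = vec n (($) v)"
      by auto
    ultimately show "0 \<le> (M *\<^sub>v v) \<bullet>c v"
      using *[of "($) v"] by metis
  next
    fix v
    assume "\<forall>v \<in> carrier_vec n. 0 \<le> (M *\<^sub>v v) \<bullet>c v"
    then have "0 \<le> (M *\<^sub>v vec n v) \<bullet>c vec n v"
      by (rule bspec) simp
    then show "0 \<le> hform n M v v"
      unfolding * .
  qed
  with assms show ?thesis
    unfolding psd_mat_def hermitian_mat_iff[OF assms] by auto
qed

definition rank1_mat :: "nat \<Rightarrow> (nat \<Rightarrow> complex) \<Rightarrow> complex mat" where
  "rank1_mat n v = mat n n (\<lambda>(x, y). v x * cnj (v y))"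

lemma rank1_mat_carrier [simp]: "rank1_mat n v \<in> carrier_mat n n"
  unfolding rank1_mat_def by simp

lemma hform_rank1_mat:
  "hform n (rank1_mat n v) u u = (\<Sum>i<n. cnj (u i) * v i) * cnj (\<Sum>i<n. cnj (u i) * v i)"
  unfolding hform_def rank1_mat_def cnj_sum sum_product
  by (intro sum.cong refl) (simp add: mult_ac)

lemma complex_mult_cnj_nonneg: "0 \<le> z * cnj z"
  by (simp add: complex_mult_cnj less_eq_complex_def)

text \<open>The hypothesis says that -c |z|^2 is non-negative. This is how entries beside a
  vanishing diagonal entry are shown to vanish.\<close>

lemma complex_mult_cnj_nonpos:
  assumes "0 \<le> - (complex_of_real c * (z * cnj z))" "c > 0"
  shows "z = 0"
proof -
  have "c * ((Re z)\<^sup>2 + (Im z)\<^sup>2) \<le> 0"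
    using assms(1) unfolding complex_mult_cnj of_real_mult[symmetric] by (simp add: less_eq_complex_def)
  then have "(Re z)\<^sup>2 + (Im z)\<^sup>2 \<le> 0"
    using assms(2) by (simp add: mult_le_0_iff)
  then show ?thesis
    by (simp add: sum_power2_le_zero_iff complex_eq_iff)
qed

lemma psd_rank1_mat: "psd_mat (rank1_mat n v)"
  by (subst psd_mat_iff_hform[of _ n])
    (auto simp: hform_rank1_mat complex_mult_cnj_nonneg simp del: cnj_sum, simp add: rank1_mat_def)

lemma rank1_mat_cong: "(\<And>x. x < n \<Longrightarrow> v x = w x) \<Longrightarrow> rank1_mat n v = rank1_mat n w"
  unfolding rank1_mat_def by (rule eq_matI) auto

text \<open>A congruence acts on the vector alone: w is replaced by C^* w.\<close>

lemma rank1_mat_congruence: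
  assumes "C \<in> carrier_mat n l"
  shows "mat_adjoint C * rank1_mat n w * C = rank1_mat l (\<lambda>x. \<Sum>z<n. cnj (C $$ (z, x)) * w z)"
proof (rule eq_matI, goal_cases)
  case (1 x y)
  then have xy: "x < l" "y < l"
    by (simp_all add: rank1_mat_def)
  have row: "(mat_adjoint C * rank1_mat n w) $$ (x, z)
      = (\<Sum>z<n. cnj (C $$ (z, x)) * w z) * cnj (w z)" if "z < n" for z
    using that xy assms
    by (simp add: rank1_mat_def scalar_prod_def atLeast0LessThan sum_distrib_right mult.assoc)
  have "(mat_adjoint C * rank1_mat n w * C) $$ (x, y)
      = (\<Sum>z'<n. (mat_adjoint C * rank1_mat n w) $$ (x, z') * C $$ (z', y))"
    using xy assms by (subst index_mult_mat(1))
      (simp_all add: rank1_mat_def scalar_prod_def atLeast0LessThan del: index_mult_mat(1))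
  also have "\<dots> = (\<Sum>z<n. cnj (C $$ (z, x)) * w z) * (\<Sum>z'<n. cnj (w z') * C $$ (z', y))"
    unfolding sum_distrib_left by (intro sum.cong refl) (simp add: row mult.assoc)
  finally show ?case
    using xy by (simp add: rank1_mat_def mult.commute)
qed (use assms in \<open>simp_all add: rank1_mat_def\<close>)

text \<open>Expansion of the form at u - s e_i. The later choices are u = 0 for the sign of a
  diagonal entry, s = K_ij at u = e_j for an off-diagonal entry, and s = (K u)_i / K_ii for
  completing the square.\<close>

lemma hform_update:
  assumes "i < n"
  shows "hform n K (\<lambda>x. u x - (if x = i then s else 0)) (\<lambda>x. u x - (if x = i then s else 0))
    = hform n K u u - cnj s * (\<Sum>y<n. K $$ (i, y) * u y) - s * (\<Sum>x<n. cnj (u x) * K $$ (x, i))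
      + cnj s * s * K $$ (i, i)"
proof -
  have inner: "(\<Sum>y<n. c * K $$ (x, y) * (u y - (if y = i then s else 0)))
      = c * (\<Sum>y<n. K $$ (x, y) * u y) - c * s * K $$ (x, i)" for x c
  proof -
    have "(\<Sum>y<n. c * K $$ (x, y) * (u y - (if y = i then s else 0)))
        = (\<Sum>y<n. c * (K $$ (x, y) * u y)) - (\<Sum>y<n. if y = i then c * s * K $$ (x, y) else 0)"
      unfolding sum_subtractf[symmetric] by (intro sum.cong refl) (auto simp: algebra_simps)
    then show ?thesis
      using assms by (simp add: sum_distrib_left)
  qed
  have "hform n K (\<lambda>x. u x - (if x = i then s else 0)) (\<lambda>x. u x - (if x = i then s else 0))
    = (\<Sum>x<n. (cnj (u x) - (if x = i then cnj s else 0))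
         * ((\<Sum>y<n. K $$ (x, y) * u y) - s * K $$ (x, i)))"
    unfolding hform_def inner by (auto simp: algebra_simps intro!: sum.cong)
  also have "\<dots> = (\<Sum>x<n. cnj (u x) * (\<Sum>y<n. K $$ (x, y) * u y))
      - s * (\<Sum>x<n. cnj (u x) * K $$ (x, i))
      - cnj s * ((\<Sum>y<n. K $$ (i, y) * u y) - s * K $$ (i, i))"
  proof -
    define T where "T x = (\<Sum>y<n. K $$ (x, y) * u y) - s * K $$ (x, i)" for x
    have "(\<Sum>x<n. (cnj (u x) - (if x = i then cnj s else 0)) * T x)
        = (\<Sum>x<n. cnj (u x) * T x) - (\<Sum>x<n. if x = i then cnj s * T x else 0)"
      by (subst sum_subtractf[symmetric]) (auto simp: algebra_simps intro!: sum.cong)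
    also have "(\<Sum>x<n. if x = i then cnj s * T x else 0) = cnj s * T i"
      using assms by simp
    also have "(\<Sum>x<n. cnj (u x) * T x) = (\<Sum>x<n. cnj (u x) * (\<Sum>y<n. K $$ (x, y) * u y))
        - s * (\<Sum>x<n. cnj (u x) * K $$ (x, i))"
      by (simp add: T_def algebra_simps sum_subtractf sum_distrib_left)
    finally show ?thesis
      unfolding T_def .
  qed
  finally show ?thesis
    by (simp add: hform_def sum_distrib_left algebra_simps)
qed

lemma psd_mat_diag_nonneg:
  assumes "psd_mat K" "K \<in> carrier_mat n n" "i < n"
  shows "0 \<le> K $$ (i, i)"
proof -
  have "0 \<le> hform n K (\<lambda>x. 0 - (if x = i then 1 else 0)) (\<lambda>x. 0 - (if x = i then 1 else 0))"
    using assms psd_mat_iff_hform by blast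
  then show ?thesis
    using hform_update[OF assms(3), of K "\<lambda>x. 0" 1] by (simp add: hform_def)
qed

text \<open>With a zero diagonal, the form at e_j - K_ij e_i equals -2 |K_ij|^2, which must be
  non-negative.\<close>

lemma psd_mat_zero_diag:
  assumes K: "psd_mat K" "K \<in> carrier_mat n n" and diag: "\<And>i. i < n \<Longrightarrow> K $$ (i, i) = 0"
  shows "K = 0\<^sub>m n n"
proof (rule eq_matI)
  fix i j assume "i < dim_row (0\<^sub>m n n :: complex mat)" "j < dim_col (0\<^sub>m n n :: complex mat)"
  then have ij: "i < n" "j < n" by auto
  have herm: "K $$ (j, i) = cnj (K $$ (i, j))"
    using K ij psd_mat_iff_hform by blast
  define u :: "nat \<Rightarrow> complex" where "u x = (if x = j then 1 else 0)" for x
  \<comment> \<open>Writing e_j as an update of the zero function lets \<open>hform_update\<close>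
    compute its form as the diagonal entry at j.\<close>
  have u0: "u = (\<lambda>x. 0 - (if x = j then - 1 else 0))"
    unfolding u_def by auto
  have "hform n K u u = 0"
    unfolding u0 hform_update[OF ij(2)] using ij diag by (simp add: hform_def)
  moreover have "(\<Sum>y<n. K $$ (i, y) * u y) = K $$ (i, j)"
    using ij unfolding u_def by (simp add: if_distrib cong: if_cong)
  moreover have "(\<Sum>x<n. cnj (u x) * K $$ (x, i)) = K $$ (j, i)"
    using ij unfolding u_def by (simp add: if_distrib if_distribR cong: if_cong)
  moreover have "0 \<le> hform n K (\<lambda>x. u x - (if x = i then K $$ (i, j) else 0))
      (\<lambda>x. u x - (if x = i then K $$ (i, j) else 0))"
    using K psd_mat_iff_hform by blast
  ultimately have "0 \<le> - (2 * (K $$ (i, j) * cnj (K $$ (i, j))))"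
    unfolding hform_update[OF ij(1)] by (simp add: diag ij herm algebra_simps)
  then show "K $$ (i, j) = 0\<^sub>m n n $$ (i, j)"
    using ij complex_mult_cnj_nonpos[of 2 "K $$ (i, j)"] by simp
qed (use K in auto)

text \<open>One step of the Cholesky factorization\<close>

lemma psd_mat_deflate:
  assumes K: "psd_mat K" "K \<in> carrier_mat n n" and i: "i < n" "K $$ (i, i) \<noteq> 0"
  obtains K' v where "psd_mat K'" "K' \<in> carrier_mat n n" "K = K' + rank1_mat n v"
    "K' $$ (i, i) = 0" "\<And>l. l < n \<Longrightarrow> K $$ (l, l) = 0 \<Longrightarrow> K' $$ (l, l) = 0"
proof -
  define \<kappa> where "\<kappa> = Re (K $$ (i, i))"
  have \<kappa>: "K $$ (i, i) = of_real \<kappa>" "\<kappa> > 0"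
    using psd_mat_diag_nonneg[OF K i(1)] i(2)
    by (auto simp: \<kappa>_def less_eq_complex_def complex_eq_iff)
  \<comment> \<open>With this scaling v v^* agrees with \<open>K\<close> in row and column i, so
    that \<open>K'\<close> is the Schur complement of the pivot padded with zeros.\<close>
  define v where "v x = K $$ (x, i) / of_real (sqrt \<kappa>)" for x
  define K' where "K' = K - rank1_mat n v"
  have herm: "K $$ (x, y) = cnj (K $$ (y, x))" if "x < n" "y < n" for x y
    using K that psd_mat_iff_hform by blast
  have sq: "complex_of_real (sqrt \<kappa>) * of_real (sqrt \<kappa>) = of_real \<kappa>"
    using \<kappa> by (simp flip: of_real_mult)
  have entry: "K' $$ (x, y) = K $$ (x, y) - K $$ (x, i) * cnj (K $$ (y, i)) / of_real \<kappa>"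
    if "x < n" "y < n" for x y
    using that K sq by (simp add: K'_def rank1_mat_def v_def)
  have K'_carrier: "K' \<in> carrier_mat n n"
    unfolding K'_def rank1_mat_def by (rule minus_carrier_mat) simp
  have nonneg: "0 \<le> hform n K' u u" for u
  proof -
    have row: "cnj (K $$ (i, y)) = K $$ (y, i)" if "y < n" for y
      using herm[OF that i(1)] by simp
    \<comment> \<open>\<open>S\<close> is the i-th entry of K u. Subtracting S / \<kappa> from the
      i-th coordinate of \<open>u\<close> minimises the form of \<open>K\<close> over that
      coordinate, and the minimum is the form of \<open>K'\<close> at \<open>u\<close>.\<close>
    define S where "S = (\<Sum>y<n. K $$ (i, y) * u y)"
    have S: "(\<Sum>x<n. cnj (u x) * K $$ (x, i)) = cnj S"
      unfolding S_def cnj_sum by (intro sum.cong refl) (simp add: row mult.commute)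
    have "hform n K (\<lambda>x. u x - (if x = i then S / of_real \<kappa> else 0))
        (\<lambda>x. u x - (if x = i then S / of_real \<kappa> else 0)) = hform n K u u - cnj S * S / of_real \<kappa>"
      unfolding hform_update[OF i(1)] S S_def[symmetric] \<kappa>(1) using \<kappa>(2) by (simp add: field_simps)
    also have "\<dots> = hform n K' u u"
    proof -
      have "cnj S * S = (\<Sum>x<n. \<Sum>y<n. cnj (u x) * (K $$ (x, i) * cnj (K $$ (y, i))) * u y)"
        unfolding S[symmetric] unfolding S_def sum_product
        by (intro sum.cong refl) (simp add: row herm[OF i(1)])
      then show ?thesis
        unfolding hform_def sum_divide_distrib
        by (auto simp: entry algebra_simps sum_subtractf sum_divide_distrib)
    qed
    finally have "hform n K' u u = hform n K (\<lambda>x. u x - (if x = i then S / of_real \<kappa> else 0))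
        (\<lambda>x. u x - (if x = i then S / of_real \<kappa> else 0))" ..
    then show ?thesis
      using K psd_mat_iff_hform by simp
  qed
  have "psd_mat K'"
    unfolding psd_mat_iff_hform[OF K'_carrier]
  proof (intro conjI allI impI nonneg)
    fix x y assume "x < n" "y < n"
    then show "K' $$ (x, y) = cnj (K' $$ (y, x))"
      using herm[of x y] by (simp add: entry)
  qed
  moreover have "K = K' + rank1_mat n v"
    using K unfolding K'_def by (auto intro!: eq_matI simp: rank1_mat_def)
  moreover have "K' $$ (i, i) = 0"
    using i \<kappa> by (simp add: entry)
  \<comment> \<open>The new entry is -|K_li|^2 / \<kappa>, and positivity of \<open>K'\<close>
    forces K_li = 0. So deflation never spoils a zero on the diagonal.\<close>
  moreover have "K' $$ (l, l) = 0" if l: "l < n" "K $$ (l, l) = 0" for l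
  proof -
    have "0 \<le> - (K $$ (l, i) * cnj (K $$ (l, i)) / of_real \<kappa>)"
      using psd_mat_diag_nonneg[OF \<open>psd_mat K'\<close> K'_carrier l(1)] l by (simp add: entry)
    then have "K $$ (l, i) = 0"
      using \<kappa>(2) by (intro complex_mult_cnj_nonpos[of "1 / \<kappa>"]) simp_all
    then show ?thesis
      using l by (simp add: entry)
  qed
  ultimately show ?thesis
    using that K'_carrier by blast
qed

text \<open>Induction on the number of non-zero diagonal entries: each deflation clears one and
  creates none, and once all are gone the matrix is zero. The rule expresses that a positive
  semidefinite matrix is a sum of matrices v v^*.\<close>

lemma psd_mat_induct [consumes 2, case_names zero rank1]:
  assumes "psd_mat K" "K \<in> carrier_mat n n"
    and zero: "P (0\<^sub>m n n)"
    and rank1: "\<And>K v. K \<in> carrier_mat n n \<Longrightarrow> P K \<Longrightarrow> P (K + rank1_mat n v)"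
  shows "P K"
  using assms(1,2)
proof (induction "card {i. i < n \<and> K $$ (i, i) \<noteq> 0}" arbitrary: K rule: less_induct)
  case less
  show ?case
  proof (cases "\<exists>i<n. K $$ (i, i) \<noteq> 0")
    case True
    then obtain i where i: "i < n" "K $$ (i, i) \<noteq> 0" by blast
    from psd_mat_deflate[OF less.prems i] obtain K' v where K': "psd_mat K'" "K' \<in> carrier_mat n n"
        "K = K' + rank1_mat n v" "K' $$ (i, i) = 0" "\<And>l. l < n \<Longrightarrow> K $$ (l, l) = 0 \<Longrightarrow> K' $$ (l, l) = 0"
      by blast
    have "{i. i < n \<and> K' $$ (i, i) \<noteq> 0} \<subset> {i. i < n \<and> K $$ (i, i) \<noteq> 0}"
      using K'(4,5) i by blast
    then have "P K'"
      by (intro less.hyps psubset_card_mono K') auto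
    then show ?thesis
      using rank1 K' by blast
  next
    case False
    then show ?thesis
      using psd_mat_zero_diag[OF less.prems] zero by auto
  qed
qed

subsection \<open>Positions in the Jordan form\<close>

text \<open>The same construction lists the blocks (j, q), the positions inside these blocks, and
  the index set of the Hill-Pick matrix.\<close>

definition labels :: "('s \<Rightarrow> nat) \<Rightarrow> 's list \<Rightarrow> ('s \<times> nat) list" where
  "labels d ss = [(s, a). s \<leftarrow> ss, a \<leftarrow> [0..<d s]]"

lemma labels_simps [simp]:
  "labels d [] = []"
  "labels d (s # ss) = map (Pair s) [0..<d s] @ labels d ss"
  unfolding labels_def by simp_all

lemma labels_append [simp]: "labels d (xs @ ys) = labels d xs @ labels d ys"
  by (induction xs) auto

lemma length_labels: "length (labels d ss) = sum_list (map d ss)"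
  by (induction ss) auto

lemma set_labels: "set (labels d ss) = {(s, a). s \<in> set ss \<and> a < d s}"
  by (induction ss) auto

lemma distinct_labels: "distinct ss \<Longrightarrow> distinct (labels d ss)"
  by (induction ss) (auto simp: distinct_map inj_on_def set_labels)

lemma labels_nth_start:
  "a < d s \<Longrightarrow> labels d (xs @ s # ys) ! (length (labels d xs) + a) = (s, a)"
  by (simp add: nth_append)

text \<open>The labels of one block are consecutive, so \<open>x - b\<close> is where the block
  containing \<open>x\<close> starts. This makes moves inside a block plain arithmetic on
  positions.\<close>

lemma labels_nth_shift:
  assumes "x < length (labels d ss)" "labels d ss ! x = (s, b)" "a < d s"
  shows "b \<le> x \<and> x - b + a < length (labels d ss) \<and> labels d ss ! (x - b + a) = (s, a)"
  using assms
proof (induction ss arbitrary: x)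
  case (Cons s0 ss)
  show ?case
  proof (cases "x < d s0")
    case True
    then show ?thesis
      using Cons.prems by (auto simp: nth_append)
  next
    case False
    then have "b \<le> x - d s0 \<and> x - d s0 - b + a < length (labels d ss)
        \<and> labels d ss ! (x - d s0 - b + a) = (s, a)"
      using Cons.prems by (intro Cons.IH) (auto simp: nth_append)
    moreover from this False have "x - b + a = d s0 + (x - d s0 - b + a)"
      by auto
    ultimately show ?thesis
      using False by (auto simp: nth_append)
  qed
qed simp

text \<open>As \<open>ss\<close> is distinct, two positions lie in the same diagonal block exactly
  when the first components of their labels agree.\<close>

lemma diag_block_mat_labels:
  assumes "distinct ss" "\<And>s. s \<in> set ss \<Longrightarrow> M s \<in> carrier_mat (d s) (d s)"
  shows "diag_block_mat (map M ss) = mat (length (labels d ss)) (length (labels d ss))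
    (\<lambda>(x, y). if fst (labels d ss ! x) = fst (labels d ss ! y)
       then M (fst (labels d ss ! x)) $$ (snd (labels d ss ! x), snd (labels d ss ! y)) else 0)"
  using assms
proof (induction ss)
  case (Cons s ss)
  let ?N = "length (labels d ss)"
  have M: "M s \<in> carrier_mat (d s) (d s)"
    using Cons.prems by simp
  have new: "fst (labels d ss ! x) \<noteq> s" if "x < ?N" for x
    using nth_mem[OF that] Cons.prems(1) by (auto simp: set_labels)
  have "diag_block_mat (map M ss) = mat ?N ?N
    (\<lambda>(x, y). if fst (labels d ss ! x) = fst (labels d ss ! y)
       then M (fst (labels d ss ! x)) $$ (snd (labels d ss ! x), snd (labels d ss ! y)) else 0)"
    using Cons by simp
  then show ?case
    using M new new[symmetric]
    by (auto intro!: eq_matI simp: Let_def nth_append)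
qed (auto intro!: eq_matI)

lemma shift_poly_eq:
  "shift_poly d c = mat d d (\<lambda>(a, b). if a \<le> b then c (b - a) else 0)"
proof (rule eq_matI, goal_cases)
  case (1 a b)
  then have ab: "a < d" "b < d" by simp_all
  have "(\<Sum>i<d. c i * (jordan_block d 0 ^\<^sub>m i) $$ (a, b))
      = (\<Sum>i<d. if i = b - a then (if a \<le> b then c i else 0) else 0)"
    using ab by (intro sum.cong refl) (auto simp: jordan_block_pow power_0_left not_le)
  also have "\<dots> = (if a \<le> b then c (b - a) else 0)"
    using ab by auto
  finally show ?case
    using ab by (simp add: shift_poly_def)
qed (simp_all add: shift_poly_def)

text \<open>The label \<open>((j, q), a)\<close> stands for the \<open>a\<close>-th position in the \<open>q\<close>-th block of the \<open>j\<close>-th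
  eigenvalue.\<close>

definition block_labels :: "nat \<Rightarrow> (nat \<Rightarrow> nat) \<Rightarrow> (nat \<Rightarrow> nat \<Rightarrow> nat) \<Rightarrow> ((nat \<times> nat) \<times> nat) list" where
  "block_labels r k m = labels (\<lambda>(j, q). m j q) (labels k [0..<r])"

lemma shift_poly_form_eq:
  "shift_poly_form r k m c = mat (length (block_labels r k m)) (length (block_labels r k m))
     (\<lambda>(x, y). let ((j, q), a) = block_labels r k m ! x; ((j', q'), b) = block_labels r k m ! y
       in if j = j' \<and> q = q' \<and> a \<le> b then c j (b - a) else 0)"
proof -
  have "shift_poly_form r k m c
      = diag_block_mat (map (\<lambda>(j, q). shift_poly (m j q) (c j)) (labels k [0..<r]))"
    unfolding shift_poly_form_def labels_def by (simp add: map_concat o_def)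
  also have "\<dots> = mat (length (block_labels r k m)) (length (block_labels r k m))
     (\<lambda>(x, y). if fst (block_labels r k m ! x) = fst (block_labels r k m ! y)
        then (\<lambda>(j, q). shift_poly (m j q) (c j)) (fst (block_labels r k m ! x))
          $$ (snd (block_labels r k m ! x), snd (block_labels r k m ! y)) else 0)"
    unfolding block_labels_def
    by (rule diag_block_mat_labels) (auto simp: distinct_labels shift_poly_def)
  also have "\<dots> = mat (length (block_labels r k m)) (length (block_labels r k m))
     (\<lambda>(x, y). let ((j, q), a) = block_labels r k m ! x; ((j', q'), b) = block_labels r k m ! y
       in if j = j' \<and> q = q' \<and> a \<le> b then c j (b - a) else 0)"
  proof (rule eq_matI, goal_cases)
    case (1 x y)
    have "snd (block_labels r k m ! z) < (\<lambda>(j, q). m j q) (fst (block_labels r k m ! z))"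
      if "z < length (block_labels r k m)" for z
      using nth_mem[OF that] by (auto simp: block_labels_def set_labels split: prod.splits)
    from this[of x] this[of y] 1 show ?case
      by (auto simp: shift_poly_eq split: prod.splits)
  qed simp_all
  finally show ?thesis .
qed

text \<open>The Jordan matrix is the case of coefficients lam j, 1, 0, 0 and so on, so every entry
  formula and commutation fact for shift polynomials also covers it.\<close>

lemma jordan_form_eq_shift_poly_form:
  "jordan_form r k m lam
    = shift_poly_form r k m (\<lambda>j i. if i = 0 then lam j else if i = 1 then 1 else 0)"
proof -
  have "jordan_block d \<mu> = shift_poly d (\<lambda>i. if i = 0 then \<mu> else if i = 1 then 1 else 0)" for d \<mu>
    by (rule eq_matI) (auto simp: shift_poly_eq jordan_block_def)
  then show ?thesis
    unfolding jordan_form_def shift_poly_form_def jordan_matrix_def by (simp add: map_concat o_def)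
qed

lemma block_start_eq: "block_start k m j = length (block_labels j k m)"
  unfolding block_start_def block_labels_def length_labels
  by (induction j) (simp_all add: o_def interv_sum_list_conv_sum_set_nat atLeast0LessThan)

lemma block_labels_nth_start:
  assumes "j < r" "0 < k j" "a < m j 0"
  shows "block_labels r k m ! (block_start k m j + a) = ((j, 0), a)"
    and "block_start k m j + a < length (block_labels r k m)"
proof -
  have "[0..<r] = [0..<j] @ j # [Suc j..<r]"
    using assms upt_add_eq_append[of 0 j "r - j"] upt_conv_Cons[of j r] by simp
  moreover have "map (Pair j) [0..<k j] = (j, 0) # map (Pair j) [1..<k j]"
    using assms upt_conv_Cons[of 0 "k j"] by simp
  ultimately have split: "labels k [0..<r]
      = labels k [0..<j] @ (j, 0) # (map (Pair j) [1..<k j] @ labels k [Suc j..<r])"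
    by simp
  show "block_labels r k m ! (block_start k m j + a) = ((j, 0), a)"
    unfolding block_labels_def split block_start_eq by (rule labels_nth_start) (use assms in simp)
  show "block_start k m j + a < length (block_labels r k m)"
    using assms unfolding block_start_eq unfolding block_labels_def split by simp
qed

subsection \<open>Solutions of the Lyapunov equation for a Jordan matrix\<close>

text \<open>The coefficient of \<open>x\<^sup>a y\<^sup>b\<close> in the power series of \<open>1 / (\<mu> + x + y)\<close>\<close>

definition hp_kernel :: "complex \<Rightarrow> nat \<Rightarrow> nat \<Rightarrow> complex" where
  "hp_kernel \<mu> a b = of_nat ((a + b) choose a) * (- 1) ^ (a + b) / \<mu> ^ (a + b + 1)"

text \<open>Coefficient comparison in (\<mu> + x + y) times the power series equal to 1; for
  positive \<open>a\<close> and \<open>b\<close> it is Pascal's rule. The conditionals stand for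
  coefficients with a negative index.\<close>

lemma hp_kernel_rec:
  assumes "\<mu> \<noteq> 0"
  shows "\<mu> * hp_kernel \<mu> a b + (if b = 0 then 0 else hp_kernel \<mu> a (b - 1))
      + (if a = 0 then 0 else hp_kernel \<mu> (a - 1) b) = (if a = 0 \<and> b = 0 then 1 else 0)"
proof (cases a; cases b)
  fix a' b' assume "a = Suc a'" "b = Suc b'"
  then show ?thesis
    using assms by (simp add: hp_kernel_def field_simps)
qed (use assms in \<open>auto simp: hp_kernel_def field_simps\<close>)

text \<open>Both sums are convolutions of the coefficients \<open>t\<close> with the kernel, after
  reversing the first one by d = a - l. This is the shape that \<open>lyap_T_index\<close>
  produces.\<close>

lemma hp_coeff_eq:
  "hp_coeff lam t j b i a
    = (\<Sum>l\<le>a. cnj (t i l) * hp_kernel (lam j + cnj (lam i)) (a - l) b)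
      + (\<Sum>l\<le>b. hp_kernel (lam j + cnj (lam i)) a (b - l) * t j l)"
proof -
  have "(\<Sum>l\<le>a. cnj (t i l) * hp_kernel (lam j + cnj (lam i)) (a - l) b)
      = (\<Sum>d\<le>a. cnj (t i (a - d)) * hp_kernel (lam j + cnj (lam i)) d b)"
    by (rule sum.reindex_bij_witness[of _ "\<lambda>l. a - l" "\<lambda>l. a - l"]) auto
  then show ?thesis
    unfolding hp_coeff_def hp_kernel_def atLeast0AtMost
    by (auto simp: mult_ac add_ac intro!: arg_cong2[of _ _ _ _ "(+)"] sum.cong)
qed

lemma sum_jordan_coeff:
  fixes f :: "nat \<Rightarrow> complex"
  shows "(\<Sum>l\<le>a. f l * (if l = 0 then p else if l = 1 then 1 else 0))
    = p * f 0 + (if a = 0 then 0 else f 1)"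
  by (induction a) auto

lemma cnj_sum_jordan_coeff:
  fixes f :: "nat \<Rightarrow> complex"
  shows "(\<Sum>l\<le>a. cnj (if l = 0 then p else if l = 1 then 1 else 0) * f l)
    = cnj p * f 0 + (if a = 0 then 0 else f 1)"
  by (induction a) auto

section \<open>Coordinates of a position: eigenvalue, block and offset\<close>

locale jordan_data =
  fixes r :: nat and k :: "nat \<Rightarrow> nat" and m :: "nat \<Rightarrow> nat \<Rightarrow> nat" and lam :: "nat \<Rightarrow> complex"
  assumes k_pos: "j < r \<Longrightarrow> 0 < k j"
    and m_le: "j < r \<Longrightarrow> q < k j \<Longrightarrow> m j q \<le> m j 0"
    and regular: "i < r \<Longrightarrow> j < r \<Longrightarrow> lam j + cnj (lam i) \<noteq> 0"
begin

abbreviation "N \<equiv> length (block_labels r k m)"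

definition "eig x = fst (fst (block_labels r k m ! x))"
definition "blk x = snd (fst (block_labels r k m ! x))"
definition "pos x = snd (block_labels r k m ! x)"

lemma label_eqI: "eig x = eig y \<Longrightarrow> blk x = blk y \<Longrightarrow> pos x = pos y
    \<Longrightarrow> block_labels r k m ! x = block_labels r k m ! y"
  by (simp add: eig_def blk_def pos_def prod_eq_iff)

lemma label_bounds:
  assumes "x < N"
  shows "eig x < r" "blk x < k (eig x)" "pos x < m (eig x) (blk x)"
  using nth_mem[OF assms] unfolding eig_def blk_def pos_def block_labels_def
  by (auto simp: set_labels)

lemma label_inj:
  assumes "x < N" "y < N" "eig x = eig y" "blk x = blk y" "pos x = pos y"
  shows "x = y"
proof -
  have "distinct (block_labels r k m)"
    unfolding block_labels_def by (simp add: distinct_labels)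
  then show ?thesis
    using nth_eq_iff_index_eq assms label_eqI by blast
qed

lemma label_shift:
  assumes "x < N" "a < m (eig x) (blk x)"
  shows "pos x \<le> x" "x - pos x + a < N" "eig (x - pos x + a) = eig x"
    "blk (x - pos x + a) = blk x" "pos (x - pos x + a) = a"
proof -
  have "block_labels r k m ! x = ((eig x, blk x), pos x)"
    by (simp add: eig_def blk_def pos_def)
  then have "pos x \<le> x \<and> x - pos x + a < N
      \<and> block_labels r k m ! (x - pos x + a) = ((eig x, blk x), a)"
    unfolding block_labels_def
    by (intro labels_nth_shift) (use assms in \<open>simp_all add: block_labels_def\<close>)
  then show "pos x \<le> x" "x - pos x + a < N" "eig (x - pos x + a) = eig x"
    "blk (x - pos x + a) = blk x" "pos (x - pos x + a) = a"
    unfolding eig_def[of "x - pos x + a"] blk_def[of "x - pos x + a"] pos_def[of "x - pos x + a"]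
    by (elim conjE; simp only: fst_conv snd_conv)+
qed

lemma label_minus:
  assumes "x < N" "l \<le> pos x"
  shows "l \<le> x" "x - l < N" "eig (x - l) = eig x" "blk (x - l) = blk x" "pos (x - l) = pos x - l"
proof -
  have "pos x - l < m (eig x) (blk x)"
    using label_bounds(3)[OF assms(1)] by simp
  note s = label_shift[OF assms(1) this]
  have "x - pos x + (pos x - l) = x - l"
    using s(1) assms(2) by simp
  with s assms(2) show "l \<le> x" "x - l < N" "eig (x - l) = eig x" "blk (x - l) = blk x"
      "pos (x - l) = pos x - l"
    by simp_all
qed

lemma label_pred:
  assumes "x < N" "pos x \<noteq> 0"
  shows "x - Suc 0 < N" "eig (x - Suc 0) = eig x" "blk (x - Suc 0) = blk x"
    "pos (x - Suc 0) = pos x - Suc 0"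
  using label_minus[OF assms(1), of 1] assms(2) by simp_all

lemma label_plus:
  assumes "x < N" "pos x + l < m (eig x) (blk x)"
  shows "x + l < N" "eig (x + l) = eig x" "blk (x + l) = blk x" "pos (x + l) = pos x + l"
  using label_shift[OF assms] by simp_all

lemma label_start:
  assumes "j < r" "a < m j 0"
  shows "block_start k m j + a < N" "eig (block_start k m j + a) = j"
    "blk (block_start k m j + a) = 0" "pos (block_start k m j + a) = a"
  using block_labels_nth_start[where m = m and k = k and j = j and a = a,
      OF assms(1) k_pos[OF assms(1)] assms(2)]
  by (simp_all add: eig_def blk_def pos_def)

section \<open>Entries and injectivity of the Lyapunov operator in these coordinates\<close>

abbreviation "T \<equiv> shift_poly_form r k m"
abbreviation "J \<equiv> jordan_form r k m lam"

lemma T_carrier [simp]: "T c \<in> carrier_mat N N"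
  unfolding shift_poly_form_eq by simp

lemma J_carrier [simp]: "J \<in> carrier_mat N N"
  unfolding jordan_form_eq_shift_poly_form by simp

lemma T_index:
  assumes "x < N" "y < N"
  shows "T c $$ (x, y)
    = (if eig x = eig y \<and> blk x = blk y \<and> pos x \<le> pos y then c (eig x) (pos y - pos x) else 0)"
  using assms by (simp add: shift_poly_form_eq eig_def blk_def pos_def case_prod_beta Let_def)

text \<open>Column \<open>y\<close> is supported on the positions of the block of \<open>y\<close>
  up to \<open>y\<close> itself, that is, on \<open>y - l\<close> with \<open>l\<close> at most
  \<open>pos y\<close>.\<close>

lemma sum_T_col:
  assumes "y < N"
  shows "(\<Sum>z<N. f z * T c $$ (z, y)) = (\<Sum>l\<le>pos y. f (y - l) * c (eig y) l)"
proof -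
  have "(\<Sum>l\<le>pos y. f (y - l) * c (eig y) l) = (\<Sum>l\<le>pos y. f (y - l) * T c $$ (y - l, y))"
    using label_minus[OF assms] assms by (intro sum.cong refl) (simp add: T_index)
  also have "\<dots> = (\<Sum>z\<in>(\<lambda>l. y - l) ` {..pos y}. f z * T c $$ (z, y))"
    using label_minus(1)[OF assms] by (subst sum.reindex) (auto simp: inj_on_def, metis diff_diff_cancel)
  also have "\<dots> = (\<Sum>z<N. f z * T c $$ (z, y))"
  proof (rule sum.mono_neutral_left, goal_cases)
    case 3
    show ?case
    proof
      fix z assume z: "z \<in> {..<N} - (\<lambda>l. y - l) ` {..pos y}"
      have "\<not> (eig z = eig y \<and> blk z = blk y \<and> pos z \<le> pos y)"
      proof
        assume *: "eig z = eig y \<and> blk z = blk y \<and> pos z \<le> pos y"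
        have "z = y - (pos y - pos z)"
          by (rule label_inj) (use * z label_minus[OF assms, of "pos y - pos z"] in simp_all)
        then show False
          using z by auto
      qed
      then show "f z * T c $$ (z, y) = 0"
        using z assms T_index by auto
    qed
  qed (use label_minus(2)[OF assms] in auto)
  finally show ?thesis ..
qed

text \<open>Row \<open>x\<close> is supported from \<open>x\<close> to the end of its block, so here
  the number of terms depends on the block size.\<close>

lemma sum_T_row:
  assumes "x < N"
  shows "(\<Sum>z<N. T c $$ (x, z) * f z)
    = (\<Sum>l<m (eig x) (blk x) - pos x. c (eig x) l * f (x + l))"
proof -
  have "(\<Sum>l<m (eig x) (blk x) - pos x. c (eig x) l * f (x + l))
      = (\<Sum>l<m (eig x) (blk x) - pos x. T c $$ (x, x + l) * f (x + l))"
    using label_plus[OF assms] assms by (intro sum.cong refl) (simp add: T_index)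
  also have "\<dots> = (\<Sum>z\<in>(\<lambda>l. x + l) ` {..<m (eig x) (blk x) - pos x}. T c $$ (x, z) * f z)"
    by (subst sum.reindex) auto
  also have "\<dots> = (\<Sum>z<N. T c $$ (x, z) * f z)"
  proof (rule sum.mono_neutral_left, goal_cases)
    case 3
    show ?case
    proof
      fix z assume z: "z \<in> {..<N} - (\<lambda>l. x + l) ` {..<m (eig x) (blk x) - pos x}"
      have "\<not> (eig x = eig z \<and> blk x = blk z \<and> pos x \<le> pos z)"
      proof
        assume *: "eig x = eig z \<and> blk x = blk z \<and> pos x \<le> pos z"
        moreover have "pos z < m (eig x) (blk x)"
          using * z label_bounds(3)[of z] by auto
        moreover have "z = x + (pos z - pos x)"
          by (rule label_inj)
            (use calculation z label_plus[OF assms, of "pos z - pos x"] in simp_all)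
        moreover have "pos z - pos x < m (eig x) (blk x) - pos x"
          using \<open>pos z < m (eig x) (blk x)\<close> * by (intro diff_less_mono) auto
        ultimately show False
          using z by blast
      qed
      then show "T c $$ (x, z) * f z = 0"
        using z assms T_index by auto
    qed
  qed (use label_plus(1)[OF assms] in auto)
  finally show ?thesis ..
qed

lemma lyap_T_index:
  assumes X: "X \<in> carrier_mat N N" and xy: "x < N" "y < N"
  shows "lyap (T c) X $$ (x, y) = (\<Sum>l\<le>pos y. X $$ (x, y - l) * c (eig y) l)
    + (\<Sum>l\<le>pos x. cnj (c (eig x) l) * X $$ (x - l, y))"
proof -
  have "(X * T c) $$ (x, y) = (\<Sum>z<N. X $$ (x, z) * T c $$ (z, y))"
    using X xy carrier_matD[OF T_carrier[of c]] by (simp add: scalar_prod_def atLeast0LessThan)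
  moreover have "(mat_adjoint (T c) * X) $$ (x, y) = cnj (\<Sum>z<N. cnj (X $$ (z, y)) * T c $$ (z, x))"
    using X xy carrier_matD[OF T_carrier[of c]]
    by (simp add: scalar_prod_def atLeast0LessThan mult.commute)
  ultimately have "(X * T c) $$ (x, y) = (\<Sum>l\<le>pos y. X $$ (x, y - l) * c (eig y) l)"
    "(mat_adjoint (T c) * X) $$ (x, y) = (\<Sum>l\<le>pos x. cnj (c (eig x) l) * X $$ (x - l, y))"
    using xy by (simp_all add: sum_T_col mult.commute)
  then show ?thesis
    using X xy carrier_matD[OF T_carrier[of c]] unfolding lyap_def by (subst index_add_mat(1)) auto
qed

lemma lyap_J_index:
  assumes "X \<in> carrier_mat N N" "x < N" "y < N"
  shows "lyap J X $$ (x, y) = (lam (eig y) + cnj (lam (eig x))) * X $$ (x, y)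
    + (if pos y = 0 then 0 else X $$ (x, y - 1)) + (if pos x = 0 then 0 else X $$ (x - 1, y))"
  unfolding jordan_form_eq_shift_poly_form lyap_T_index[OF assms] sum_jordan_coeff
    cnj_sum_jordan_coeff by (simp add: algebra_simps)

text \<open>The operator is triangular: its equation at (x, y) involves only this entry and its
  predecessors in row and column. The coefficient of the entry is non-zero by regularity, so
  induction on \<open>x + y\<close> works.\<close>

lemma lyap_J_zero:
  assumes X: "X \<in> carrier_mat N N" and zero: "lyap J X = 0\<^sub>m N N"
  shows "X = 0\<^sub>m N N"
proof -
  have "X $$ (x, y) = 0" if "x < N" "y < N" for x y
    using that
  proof (induction "x + y" arbitrary: x y rule: less_induct)
    case less
    have "pos y \<noteq> 0 \<longrightarrow> X $$ (x, y - 1) = 0" "pos x \<noteq> 0 \<longrightarrow> X $$ (x - 1, y) = 0"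
      using less label_minus(1)[of y 1] label_minus(1)[of x 1] by auto
    then have "(lam (eig y) + cnj (lam (eig x))) * X $$ (x, y) = 0"
      using lyap_J_index[OF X less.prems] zero less.prems by (simp split: if_splits)
    moreover have "lam (eig y) + cnj (lam (eig x)) \<noteq> 0"
      using regular label_bounds(1) less.prems by blast
    ultimately show ?case
      by simp
  qed
  then show ?thesis
    using X by (auto intro!: eq_matI)
qed

lemma lyap_J_inj:
  assumes "X \<in> carrier_mat N N" "X' \<in> carrier_mat N N" "lyap J X = lyap J X'"
  shows "X = X'"
proof -
  have "lyap J (X - X') = 0\<^sub>m N N"
    unfolding lyap_diff[OF J_carrier assms(1,2)] assms(3)
    using lyap_carrier[OF J_carrier assms(2)] by (intro eq_matI) auto
  then have "X - X' = 0\<^sub>m N N"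
    using minus_carrier_mat[OF assms(2)] lyap_J_zero by blast
  moreover have "X $$ (x, y) = (X - X') $$ (x, y) + X' $$ (x, y)" if "x < N" "y < N" for x y
    using assms(1,2) that by simp
  ultimately show ?thesis
    using assms(1,2) by (auto intro!: eq_matI)
qed

text \<open>The weight \<open>F\<close> allows two uses: the indicator of one pair of eigenvalues
  gives the preimage of a matrix unit, which yields entries of the Hill-Pick matrix, and the
  constant 1 gives the preimage of w w^* for domination.\<close>

definition hp_sol :: "(nat \<Rightarrow> nat \<Rightarrow> complex) \<Rightarrow> complex mat" where
  "hp_sol F = mat N N (\<lambda>(x, y). if blk x = 0 \<and> blk y = 0
     then F (eig x) (eig y) * hp_kernel (lam (eig y) + cnj (lam (eig x))) (pos x) (pos y) else 0)"

definition hp_img :: "(nat \<Rightarrow> nat \<Rightarrow> complex) \<Rightarrow> (nat \<Rightarrow> nat \<Rightarrow> complex) \<Rightarrow> complex mat" where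
  "hp_img t F = mat N N (\<lambda>(x, y). if blk x = 0 \<and> blk y = 0
     then F (eig x) (eig y) * hp_coeff lam t (eig y) (pos y) (eig x) (pos x) else 0)"

lemma hp_sol_carrier [simp]: "hp_sol F \<in> carrier_mat N N"
  unfolding hp_sol_def by simp

lemma hp_img_carrier [simp]: "hp_img t F \<in> carrier_mat N N"
  unfolding hp_img_def by simp

lemma lyap_J_hp_sol:
  "lyap J (hp_sol F) = mat N N (\<lambda>(x, y). if blk x = 0 \<and> blk y = 0 \<and> pos x = 0 \<and> pos y = 0
     then F (eig x) (eig y) else 0)"
proof (rule eq_matI, goal_cases)
  case (1 x y)
  then have xy: "x < N" "y < N" by simp_all
  show ?case
  proof (cases "blk x = 0 \<and> blk y = 0")
    case True
    let ?\<mu> = "lam (eig y) + cnj (lam (eig x))"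
    have "lyap J (hp_sol F) $$ (x, y) = F (eig x) (eig y) * (?\<mu> * hp_kernel ?\<mu> (pos x) (pos y)
        + (if pos y = 0 then 0 else hp_kernel ?\<mu> (pos x) (pos y - 1))
        + (if pos x = 0 then 0 else hp_kernel ?\<mu> (pos x - 1) (pos y)))"
      unfolding lyap_J_index[OF hp_sol_carrier xy]
      using True xy by (simp add: hp_sol_def label_pred algebra_simps)
    also have "\<dots> = F (eig x) (eig y) * (if pos x = 0 \<and> pos y = 0 then 1 else 0)"
      using regular xy label_bounds(1) by (subst hp_kernel_rec) auto
    finally show ?thesis
      using True xy by simp
  next
    case False
    then show ?thesis
      unfolding lyap_J_index[OF hp_sol_carrier xy]
      using xy by (cases "blk x = 0"; cases "pos x = 0"; cases "pos y = 0")
        (simp_all add: hp_sol_def label_pred)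
  qed
qed (use carrier_matD[OF lyap_carrier[OF J_carrier hp_sol_carrier]] in simp_all)

text \<open>Going back \<open>l\<close> positions stays in the block and lowers the offset by
  \<open>l\<close>, so the two sums of \<open>lyap_T_index\<close> become the two convolutions of
  \<open>hp_coeff_eq\<close>.\<close>

lemma lyap_T_hp_sol: "lyap (T t) (hp_sol F) = hp_img t F"
proof (rule eq_matI, goal_cases)
  case (1 x y)
  then have xy: "x < N" "y < N" by (simp_all add: hp_img_def)
  show ?case
    unfolding lyap_T_index[OF hp_sol_carrier xy]
    using xy label_minus[OF xy(1)] label_minus[OF xy(2)]
    by (simp add: hp_sol_def hp_img_def hp_coeff_eq distrib_left sum_distrib_left mult_ac)
qed (use carrier_matD[OF lyap_carrier[OF T_carrier[of t] hp_sol_carrier]]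
    carrier_matD[OF hp_img_carrier] in simp_all)

section \<open>The cyclic vector w, commuting block Toeplitz matrices, and domination\<close>

definition start_ind :: "nat \<Rightarrow> complex" where
  "start_ind x = (if blk x = 0 \<and> pos x = 0 then 1 else 0)"

lemma lyap_J_hp_sol_one: "lyap J (hp_sol (\<lambda>i j. 1)) = rank1_mat N start_ind"
  unfolding lyap_J_hp_sol rank1_mat_def start_ind_def by (rule eq_matI) auto

text \<open>The row at the start of block (j, 0) holds \<open>u\<close> on all positions of lam j,
  including those in the smaller blocks. The following rows of that block are its shifts within each
  block; rows of the other blocks vanish.\<close>

definition toeplitz :: "(nat \<Rightarrow> complex) \<Rightarrow> complex mat" where
  "toeplitz u = mat N N (\<lambda>(x, y).
     if eig x = eig y \<and> blk x = 0 \<and> pos x \<le> pos y then u (y - pos x) else 0)"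

lemma toeplitz_carrier [simp]: "toeplitz u \<in> carrier_mat N N"
  unfolding toeplitz_def by simp

text \<open>Both products convolve \<open>c\<close> with \<open>u\<close> along the blocks. They
  differ only in the cut-off of the sum, and the surplus terms vanish because block 0 is a largest
  one.\<close>

lemma toeplitz_commute: "toeplitz u * T c = T c * toeplitz u"
proof (rule eq_matI, goal_cases)
  case (1 x y)
  then have xy: "x < N" "y < N"
    using carrier_matD[OF T_carrier[of c]] carrier_matD[OF toeplitz_carrier[of u]] by simp_all
  let ?b = "m (eig x) (blk x) - pos x"
  have "(toeplitz u * T c) $$ (x, y) = (\<Sum>z<N. toeplitz u $$ (x, z) * T c $$ (z, y))"
    using xy carrier_matD[OF T_carrier[of c]] carrier_matD[OF toeplitz_carrier[of u]]
    by (simp add: scalar_prod_def atLeast0LessThan)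
  also have "\<dots> = (\<Sum>l\<le>pos y. toeplitz u $$ (x, y - l) * c (eig y) l)"
    using xy(2) by (rule sum_T_col)
  also have "\<dots> = (\<Sum>l<?b. c (eig x) l * toeplitz u $$ (x + l, y))"
  proof (rule sum.mono_neutral_cong, goal_cases)
    case (3 l)
    then have "\<not> pos x + l \<le> pos y" "pos x + l < m (eig x) (blk x)"
      by auto
    then show ?case
      using xy label_plus[OF xy(1), of l] by (simp add: toeplitz_def)
  next
    \<comment> \<open>Here the row sum has already reached the end of the block of \<open>x\<close>.
      A non-zero term would need \<open>pos x + l\<close> at most \<open>pos y\<close> in block 0 of
      the same eigenvalue, yet \<open>pos y\<close> is below the size of that block.\<close>
    case (4 l)
    then have "\<not> pos x + l < m (eig x) (blk x)" "l \<le> pos y"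
      by auto
    moreover have "m (eig y) (blk y) \<le> m (eig y) 0"
      using label_bounds[OF xy(2)] m_le by simp
    ultimately have "\<not> (eig x = eig y \<and> blk x = 0 \<and> pos x \<le> pos y - l)"
      using label_bounds(3)[OF xy(2)] by auto
    then show ?case
      using xy label_minus[OF xy(2) \<open>l \<le> pos y\<close>] by (simp add: toeplitz_def) auto
  next
    case (5 l)
    then have l: "l \<le> pos y" "pos x + l < m (eig x) (blk x)"
      by auto
    then have "pos x \<le> pos y - l \<longleftrightarrow> pos x + l \<le> pos y"
      by auto
    then show ?case
      using xy label_minus[OF xy(2) l(1)] label_plus[OF xy(1) l(2)]
      by (simp add: toeplitz_def add.commute)
  qed auto
  also have "\<dots> = (\<Sum>z<N. T c $$ (x, z) * toeplitz u $$ (z, y))"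
    using xy(1) by (rule sum_T_row[symmetric])
  also have "\<dots> = (T c * toeplitz u) $$ (x, y)"
    using xy carrier_matD[OF T_carrier[of c]] carrier_matD[OF toeplitz_carrier[of u]]
    by (simp add: scalar_prod_def atLeast0LessThan)
  finally show ?case .
qed (use carrier_matD[OF T_carrier[of c]] carrier_matD[OF toeplitz_carrier[of u]] in simp_all)

text \<open>Among the positions where w is non-zero, only the one belonging to the eigenvalue of
  \<open>y\<close> meets column \<open>y\<close>, and there the Toeplitz entry is
  \<open>u y\<close>.\<close>

lemma sum_start_ind_toeplitz:
  assumes "y < N"
  shows "(\<Sum>z<N. cnj (toeplitz u $$ (z, y)) * start_ind z) = cnj (u y)"
proof -
  have "m (eig y) 0 > 0"
    using label_bounds[OF assms] m_le[of "eig y" "blk y"] by simp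
  note s = label_start[OF label_bounds(1)[OF assms] this, unfolded add_0_right]
  have "cnj (toeplitz u $$ (z, y)) * start_ind z
      = (if z = block_start k m (eig y) then cnj (u y) else 0)" if "z < N" for z
  proof (cases "z = block_start k m (eig y)")
    case True
    then show ?thesis
      using s assms by (simp add: toeplitz_def start_ind_def)
  next
    case False
    then have "\<not> (eig z = eig y \<and> blk z = 0 \<and> pos z = 0)"
      using s label_inj[OF that s(1)] by metis
    then show ?thesis
      using that assms False by (auto simp: toeplitz_def start_ind_def)
  qed
  then have "(\<Sum>z<N. cnj (toeplitz u $$ (z, y)) * start_ind z)
      = (\<Sum>z<N. if z = block_start k m (eig y) then cnj (u y) else 0)"
    by (intro sum.cong refl) simp
  then show ?thesis
    using s(1) by simp
qed

lemma rank1_mat_toeplitz: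
  "mat_adjoint (toeplitz u) * rank1_mat N start_ind * toeplitz u = rank1_mat N (\<lambda>x. cnj (u x))"
  unfolding rank1_mat_congruence[OF toeplitz_carrier]
  by (rule rank1_mat_cong) (rule sum_start_ind_toeplitz)

text \<open>The solution is assembled along the rank-one decomposition of \<open>K\<close>: the
  summand v v^* contributes the congruence of \<open>hp_sol\<close> by a Toeplitz matrix. Since this
  matrix commutes with both \<open>J\<close> and \<open>T t\<close>, the second operator yields a
  congruence of the positive semidefinite \<open>hp_img\<close>.\<close>

lemma lyap_positive:
  assumes G: "psd_mat (hp_img t (\<lambda>i j. 1))" and K: "psd_mat K" "K \<in> carrier_mat N N"
  shows "\<exists>X \<in> carrier_mat N N. lyap J X = K \<and> psd_mat (lyap (T t) X)"
  using K
proof (induction rule: psd_mat_induct)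
  case zero
  have "psd_mat (0\<^sub>m N N)"
    by (subst psd_mat_iff_hform[of _ N]) (simp_all add: hform_def)
  then show ?case
    by (intro bexI[of _ "0\<^sub>m N N"]) (simp_all add: lyap_zero[of _ N])
next
  case (rank1 K v)
  then obtain X where X: "X \<in> carrier_mat N N" "lyap J X = K" "psd_mat (lyap (T t) X)"
    by blast
  let ?C = "toeplitz (\<lambda>x. cnj (v x))"
  let ?Y = "mat_adjoint ?C * hp_sol (\<lambda>i j. 1) * ?C"
  have Y: "?Y \<in> carrier_mat N N"
    by (rule mult_carrier_mat[OF mult_carrier_mat[OF mat_adjoint_carrier[OF toeplitz_carrier]
          hp_sol_carrier] toeplitz_carrier])
  have "lyap J ?Y = rank1_mat N v"
    by (subst lyap_congruence[OF J_carrier J_carrier hp_sol_carrier toeplitz_carrier])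
      (simp_all add: jordan_form_eq_shift_poly_form toeplitz_commute,
        simp add: jordan_form_eq_shift_poly_form[symmetric] lyap_J_hp_sol_one rank1_mat_toeplitz)
  then have "lyap J (X + ?Y) = K + rank1_mat N v"
    using X Y by (simp add: lyap_add[OF J_carrier])
  moreover have "lyap (T t) ?Y = mat_adjoint ?C * hp_img t (\<lambda>i j. 1) * ?C"
    by (subst lyap_congruence[OF T_carrier T_carrier hp_sol_carrier toeplitz_carrier])
      (simp_all add: toeplitz_commute lyap_T_hp_sol)
  then have "psd_mat (lyap (T t) ?Y)"
    using psd_mat_congruence[OF G hp_img_carrier toeplitz_carrier] by simp
  then have "psd_mat (lyap (T t) (X + ?Y))"
    unfolding lyap_add[OF T_carrier X(1) Y]
    using X(3) by (intro psd_mat_add[OF _ _ lyap_carrier[OF T_carrier X(1)]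
          lyap_carrier[OF T_carrier Y]])
  ultimately show ?case
    using X Y by (intro bexI[of _ "X + ?Y"]) auto
qed

text \<open>For necessity test domination on \<open>hp_sol\<close> with weight 1, which is Hermitian
  by symmetry of the kernel and is sent by \<open>lyap J\<close> to w w^* itself. For sufficiency,
  injectivity identifies \<open>H\<close> with the solution from
  \<open>lyap_positive\<close>.\<close>

lemma lyapunov_dominates_iff_hp_img:
  "lyapunov_dominates (T t) J \<longleftrightarrow> psd_mat (hp_img t (\<lambda>i j. 1))"
proof
  assume dom: "lyapunov_dominates (T t) J"
  have "hermitian_mat (hp_sol (\<lambda>i j. 1))"
    unfolding hermitian_mat_iff[OF hp_sol_carrier]
  proof (intro allI impI)
    fix x y assume xy: "x < N" "y < N"
    have "(pos x + pos y choose pos x) = (pos x + pos y choose pos y)"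
      using binomial_symmetric[of "pos x" "pos x + pos y"] by simp
    then show "hp_sol (\<lambda>i j. 1) $$ (x, y) = cnj (hp_sol (\<lambda>i j. 1) $$ (y, x))"
      using xy by (simp add: hp_sol_def hp_kernel_def add.commute)
  qed
  then show "psd_mat (hp_img t (\<lambda>i j. 1))"
    using dom psd_rank1_mat carrier_matD[OF J_carrier] unfolding lyapunov_dominates_iff_lyap
    by (metis hp_sol_carrier lyap_J_hp_sol_one lyap_T_hp_sol)
next
  assume G: "psd_mat (hp_img t (\<lambda>i j. 1))"
  have "psd_mat (lyap (T t) H)" if H: "H \<in> carrier_mat N N" "psd_mat (lyap J H)" for H
  proof -
    obtain X where "X \<in> carrier_mat N N" "lyap J X = lyap J H" "psd_mat (lyap (T t) X)"
      using lyap_positive[OF G H(2) lyap_carrier[OF J_carrier H(1)]] by blast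
    then show ?thesis
      using lyap_J_inj H(1) by blast
  qed
  then show "lyapunov_dominates (T t) J"
    unfolding lyapunov_dominates_iff_lyap using carrier_matD[OF J_carrier] by simp
qed

end

subsection \<open>The Hill-Pick matrix\<close>

definition vec_of_mat :: "nat \<Rightarrow> complex mat \<Rightarrow> complex vec" where
  "vec_of_mat n X = vec (n * n) (\<lambda>i. X $$ (i mod n, i div n))"

lemma vec_of_mat_carrier [simp]: "vec_of_mat n X \<in> carrier_vec (n * n)"
  unfolding vec_of_mat_def by simp

lemma mult_add_less:
  fixes u x n :: nat
  assumes "u < n" "x < n"
  shows "u * n + x < n * n"
proof -
  have "u * n + x < Suc u * n"
    using assms by simp
  also have "\<dots> \<le> n * n"
    using assms by (intro mult_le_mono1) simp
  finally show ?thesis .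
qed

lemma sum_div_mod:
  fixes f :: "nat \<Rightarrow> nat \<Rightarrow> complex"
  shows "(\<Sum>i<n * n. f (i div n) (i mod n)) = (\<Sum>p<n. \<Sum>q<n. f p q)"
proof -
  have "(\<Sum>(p, q)\<in>{..<n} \<times> {..<n}. f p q) = (\<Sum>i<n * n. f (i div n) (i mod n))"
    by (rule sum.reindex_bij_witness[of _ "\<lambda>i. (i div n, i mod n)" "\<lambda>(p, q). p * n + q"])
      (auto simp: mult_add_less less_mult_imp_div_less intro!: mod_less_divisor gr0I)
  then show ?thesis
    by (simp add: sum.cartesian_product)
qed

lemma lyapunov_op_mat_carrier:
  "Y \<in> carrier_mat n n \<Longrightarrow> lyapunov_op_mat Y \<in> carrier_mat (n * n) (n * n)"
  unfolding lyapunov_op_mat_def kron_def by auto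

lemma lyapunov_op_mat_mult_vec:
  assumes Y: "Y \<in> carrier_mat n n" and X: "X \<in> carrier_mat n n"
  shows "lyapunov_op_mat Y *\<^sub>v vec_of_mat n X = vec_of_mat n (lyap Y X)"
proof (rule eq_vecI, goal_cases)
  case (1 i)
  then have i: "i < n * n" by (simp add: vec_of_mat_def)
  then have "n > 0"
    by (cases n) auto
  \<comment> \<open>Column stacking: \<open>x\<close> is the row and \<open>u\<close> the column of
    the matrix entry stored at \<open>i\<close>.\<close>
  define x u where "x = i mod n" and "u = i div n"
  have xu: "x < n" "u < n"
    using i \<open>n > 0\<close> by (auto simp: x_def u_def less_mult_imp_div_less)
  have entry: "lyapunov_op_mat Y $$ (i, j) = Y $$ (j div n, u) * (if x = j mod n then 1 else 0)
      + (if u = j div n then 1 else 0) * cnj (Y $$ (j mod n, x))" if "j < n * n" for j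
    using Y i that xu \<open>n > 0\<close> unfolding lyapunov_op_mat_def kron_def
    by (simp add: less_mult_imp_div_less x_def u_def)
  have "(lyapunov_op_mat Y *\<^sub>v vec_of_mat n X) $ i
      = (\<Sum>j<n * n. lyapunov_op_mat Y $$ (i, j) * X $$ (j mod n, j div n))"
    using i carrier_matD[OF lyapunov_op_mat_carrier[OF Y]]
    by (simp add: scalar_prod_def vec_of_mat_def atLeast0LessThan)
  also have "\<dots> = (\<Sum>j<n * n. (\<lambda>p q. (Y $$ (p, u) * (if x = q then 1 else 0)
      + (if u = p then 1 else 0) * cnj (Y $$ (q, x))) * X $$ (q, p)) (j div n) (j mod n))"
    by (intro sum.cong refl) (simp add: entry)
  also have "\<dots> = (\<Sum>p<n. \<Sum>q<n. (Y $$ (p, u) * (if x = q then 1 else 0)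
      + (if u = p then 1 else 0) * cnj (Y $$ (q, x))) * X $$ (q, p))"
    by (rule sum_div_mod)
  also have "\<dots> = (\<Sum>p<n. \<Sum>q<n. (if q = x then Y $$ (p, u) * X $$ (q, p) else 0)
      + (if p = u then cnj (Y $$ (q, x)) * X $$ (q, p) else 0))"
    by (intro sum.cong refl) (simp add: distrib_right)
  also have "\<dots> = (\<Sum>p<n. \<Sum>q<n. if q = x then Y $$ (p, u) * X $$ (q, p) else 0)
      + (\<Sum>p<n. \<Sum>q<n. if p = u then cnj (Y $$ (q, x)) * X $$ (q, p) else 0)"
    by (simp only: sum.distrib)
  also have "\<dots> = (\<Sum>p<n. \<Sum>q<n. if q = x then Y $$ (p, u) * X $$ (q, p) else 0)
      + (\<Sum>p<n. if p = u then \<Sum>q<n. cnj (Y $$ (q, x)) * X $$ (q, p) else 0)"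
    by (intro arg_cong2[of _ _ _ _ "(+)"] sum.cong refl) simp
  also have "\<dots> = (\<Sum>p<n. X $$ (x, p) * Y $$ (p, u)) + (\<Sum>q<n. cnj (Y $$ (q, x)) * X $$ (q, u))"
    using xu by (simp add: mult.commute)
  also have "\<dots> = lyap Y X $$ (x, u)"
    using xu X Y unfolding lyap_def by (simp add: scalar_prod_def atLeast0LessThan)
  finally show ?case
    using i by (simp add: vec_of_mat_def x_def u_def)
qed (use carrier_matD[OF lyapunov_op_mat_carrier[OF Y]] in \<open>simp add: vec_of_mat_def\<close>)

lemma vec_of_mat_surj:
  assumes "v \<in> carrier_vec (n * n)"
  obtains X where "X \<in> carrier_mat n n" "v = vec_of_mat n X"
proof
  let ?X = "mat n n (\<lambda>(x, u). v $ (u * n + x))"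
  show "v = vec_of_mat n ?X"
  proof (rule eq_vecI, goal_cases)
    case (1 i)
    then have i: "i < n * n" by (simp add: vec_of_mat_def)
    then have "n > 0"
      by (cases n) auto
    then show ?case
      using i by (simp add: vec_of_mat_def less_mult_imp_div_less)
  qed (use assms in \<open>simp add: vec_of_mat_def\<close>)
qed simp

lemma vec_of_mat_unit:
  assumes "y < n" "v < n"
  shows "vec_of_mat n (mat n n (\<lambda>(x, u). if x = y \<and> u = v then 1 else 0)) = unit_vec (n * n) (v * n + y)"
proof (rule eq_vecI, goal_cases)
  case (1 i)
  then have i: "i < n * n" by simp
  have "i mod n = y \<and> i div n = v \<longleftrightarrow> i = v * n + y"
    using assms by (metis div_mult_mod_eq div_mult_self3 mod_less mod_mult_self3 add.commute
        add_0_right div_less less_nat_zero_code)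
  then show ?case
    using i assms mod_less_divisor[of n i] by (simp add: vec_of_mat_def less_mult_imp_div_less mult_add_less)
qed (simp add: vec_of_mat_def)

text \<open>A trivial kernel gives a non-zero determinant, so \<open>mat_inverse\<close> returns
  \<open>Some\<close> and \<open>the\<close> is meaningful.\<close>

lemma mat_inverse_left:
  fixes M :: "complex mat"
  assumes M: "M \<in> carrier_mat n n" and ker: "\<And>v. v \<in> carrier_vec n \<Longrightarrow> M *\<^sub>v v = 0\<^sub>v n \<Longrightarrow> v = 0\<^sub>v n"
  shows "the (mat_inverse M) * M = 1\<^sub>m n" "the (mat_inverse M) \<in> carrier_mat n n"
proof -
  have "det M \<noteq> 0"
    using det_0_iff_vec_prod_zero_field[OF M] ker by blast
  then have "M \<in> Units (ring_mat TYPE(complex) n ())"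
    by (rule det_non_zero_imp_unit[OF M])
  then obtain N where "mat_inverse M = Some N"
    using mat_inverse(1)[OF M, of "()"] by (cases "mat_inverse M") auto
  then show "the (mat_inverse M) * M = 1\<^sub>m n" "the (mat_inverse M) \<in> carrier_mat n n"
    using mat_inverse(2)[OF M] by auto
qed

text \<open>Column \<open>v * n + y\<close> is the image of the vectorized matrix unit at (y, v).
  Knowing one solution \<open>X\<close> for this unit, the inverse can be evaluated there without
  being computed.\<close>

lemma L_mat_index:
  assumes Y: "Y \<in> carrier_mat n n" and Z: "Z \<in> carrier_mat n n" and X: "X \<in> carrier_mat n n"
    and inj: "\<And>X. X \<in> carrier_mat n n \<Longrightarrow> lyap Y X = 0\<^sub>m n n \<Longrightarrow> X = 0\<^sub>m n n"
    and sol: "lyap Y X = mat n n (\<lambda>(x', u'). if x' = y \<and> u' = v then 1 else 0)"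
    and bounds: "x < n" "u < n" "y < n" "v < n"
  shows "L_mat Y Z $$ (u * n + x, v * n + y) = lyap Z X $$ (x, u)"
proof -
  note carY = lyapunov_op_mat_carrier[OF Y] and carZ = lyapunov_op_mat_carrier[OF Z]
  let ?I = "the (mat_inverse (lyapunov_op_mat Y))"
  have ker: "w = 0\<^sub>v (n * n)"
    if w: "w \<in> carrier_vec (n * n)" "lyapunov_op_mat Y *\<^sub>v w = 0\<^sub>v (n * n)" for w
  proof -
    obtain W where W: "W \<in> carrier_mat n n" "w = vec_of_mat n W"
      using vec_of_mat_surj[OF w(1)] .
    have "lyap Y W = 0\<^sub>m n n"
    proof (rule eq_matI, goal_cases)
      case (1 i j)
      then have ij: "i < n" "j < n" by simp_all
      have "vec_of_mat n (lyap Y W) $ (j * n + i) = 0"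
        using w(2) ij unfolding W(2) lyapunov_op_mat_mult_vec[OF Y W(1)] by (simp add: mult_add_less)
      then show ?case
        using ij by (simp add: vec_of_mat_def mult_add_less)
    qed (use carrier_matD[OF lyap_carrier[OF Y W(1)]] in simp_all)
    then have "W = 0\<^sub>m n n"
      by (rule inj[OF W(1)])
    then show ?thesis
      unfolding W(2) by (intro eq_vecI) (auto simp: vec_of_mat_def less_mult_imp_div_less intro!: index_zero_mat mod_less_divisor gr0I)
  qed
  note inv = mat_inverse_left[OF carY ker]
  let ?e = "unit_vec (n * n) (v * n + y) :: complex vec"
  have e: "?e = lyapunov_op_mat Y *\<^sub>v vec_of_mat n X"
    unfolding lyapunov_op_mat_mult_vec[OF Y X] sol by (rule vec_of_mat_unit[OF bounds(3,4), symmetric])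
  have "?I *\<^sub>v ?e = vec_of_mat n X"
    unfolding e using assoc_mult_mat_vec[OF inv(2) carY, symmetric] inv(1) by simp
  then have "L_mat Y Z *\<^sub>v ?e = vec_of_mat n (lyap Z X)"
    unfolding L_mat_def using assoc_mult_mat_vec[OF carZ inv(2)] lyapunov_op_mat_mult_vec[OF Z X]
    by simp
  moreover have L: "L_mat Y Z \<in> carrier_mat (n * n) (n * n)"
    unfolding L_mat_def using mult_carrier_mat[OF carZ inv(2)] .
  then have "(L_mat Y Z *\<^sub>v ?e) $ (u * n + x) = L_mat Y Z $$ (u * n + x, v * n + y)"
    using bounds by (simp add: mult_add_less)
  ultimately show ?thesis
    using bounds by (simp add: vec_of_mat_def mult_add_less)
qed

section \<open>Indexing and blocks of the Hill-Pick matrix\<close>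

lemma hp_index_eq: "hp_index r m = labels (\<lambda>i. m i 0) [0..<r]"
  unfolding hp_index_def labels_def ..

definition hp_start :: "(nat \<Rightarrow> nat \<Rightarrow> nat) \<Rightarrow> nat \<Rightarrow> nat" where
  "hp_start m i = (\<Sum>j<i. m j 0)"

lemma hp_index_nth_start:
  assumes "i < r" "a < m i 0"
  shows "hp_index r m ! (hp_start m i + a) = (i, a)" "hp_start m i + a < length (hp_index r m)"
proof -
  have split: "[0..<r] = [0..<i] @ i # [Suc i..<r]"
    using assms upt_add_eq_append[of 0 i "r - i"] upt_conv_Cons[of i r] by simp
  have start: "hp_start m i = length (labels (\<lambda>i. m i 0) [0..<i])"
    unfolding hp_start_def length_labels interv_sum_list_conv_sum_set_nat
    by (simp add: atLeast0LessThan)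
  show "hp_index r m ! (hp_start m i + a) = (i, a)"
    unfolding hp_index_eq split start by (rule labels_nth_start) (use assms in simp)
  show "hp_start m i + a < length (hp_index r m)"
    unfolding hp_index_eq split start using assms by simp
qed

lemma hp_index_cases:
  assumes "u < length (hp_index r m)"
  obtains i a where "i < r" "a < m i 0" "u = hp_start m i + a" "hp_index r m ! u = (i, a)"
proof -
  obtain i a where ia: "hp_index r m ! u = (i, a)"
    by fastforce
  then have "i < r" "a < m i 0"
    using nth_mem[OF assms] unfolding hp_index_eq by (auto simp: set_labels)
  moreover have "distinct (hp_index r m)"
    unfolding hp_index_eq by (simp add: distinct_labels)
  ultimately have "u = hp_start m i + a"
    using nth_eq_iff_index_eq[of "hp_index r m" u "hp_start m i + a"] assms
      hp_index_nth_start[of i r a m] ia by simp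
  then show ?thesis
    using that \<open>i < r\<close> \<open>a < m i 0\<close> ia by blast
qed

lemma hp_index_rows:
  assumes "i < r"
  shows "{u. u < length (hp_index r m) \<and> fst (hp_index r m ! u) = i}
    = {hp_start m i..<hp_start m i + m i 0}"
proof (intro equalityI subsetI)
  fix u assume "u \<in> {u. u < length (hp_index r m) \<and> fst (hp_index r m ! u) = i}"
  then show "u \<in> {hp_start m i..<hp_start m i + m i 0}"
    by (auto elim!: hp_index_cases)
next
  fix u assume u: "u \<in> {hp_start m i..<hp_start m i + m i 0}"
  then have "u - hp_start m i < m i 0" "u = hp_start m i + (u - hp_start m i)"
    by auto
  then show "u \<in> {u. u < length (hp_index r m) \<and> fst (hp_index r m ! u) = i}"
    using hp_index_nth_start[OF assms, of "u - hp_start m i" m] by auto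
qed

text \<open>\<open>submatrix\<close> numbers the chosen rows and columns by rank, and in an interval
  starting at \<open>s\<close> exactly \<open>a\<close> elements lie below
  \<open>s + a\<close>.\<close>

lemma submatrix_intervals:
  assumes "s + d \<le> dim_row M" "s' + d' \<le> dim_col M"
  shows "submatrix M {s..<s + d} {s'..<s' + d'} = mat d d' (\<lambda>(a, b). M $$ (s + a, s' + b))"
proof -
  have rows: "{i. i < dim_row M \<and> i \<in> {s..<s + d}} = {s..<s + d}"
    and cols: "{j. j < dim_col M \<and> j \<in> {s'..<s' + d'}} = {s'..<s' + d'}"
    using assms by auto
  have below: "{z \<in> {p..<p + q}. z < p + a} = {p..<p + a}" if "a < q" for p q a :: nat
    using that by auto
  show ?thesis
  proof (rule eq_matI, goal_cases)
    case (1 a b)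
    then have ab: "a < d" "b < d'" by simp_all
    then have "submatrix M {s..<s + d} {s'..<s' + d'}
        $$ (card {z \<in> {s..<s + d}. z < s + a}, card {z \<in> {s'..<s' + d'}. z < s' + b})
      = M $$ (s + a, s' + b)"
      using assms by (intro submatrix_index_card) auto
    then show ?case
      using ab unfolding below[OF ab(1)] below[OF ab(2)] by simp
  qed (use arg_cong[OF rows, of card] arg_cong[OF cols, of card] in \<open>simp_all add: dim_submatrix\<close>)
qed

lemma dim_hill_pick_mat:
  "dim_row (hill_pick_mat r k m lam t) = length (hp_index r m)"
  "dim_col (hill_pick_mat r k m lam t) = length (hp_index r m)"
  unfolding hill_pick_mat_def by (simp_all add: Let_def)

lemma hill_pick_block_eq:
  assumes "i < r" "j < r"
  shows "hill_pick_block r k m lam t i j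
    = mat (m i 0) (m j 0) (\<lambda>(a, b). hill_pick_mat r k m lam t $$ (hp_start m i + a, hp_start m j + b))"
proof -
  have "hp_start m i + m i 0 \<le> length (hp_index r m)" if "i < r" for i
  proof (cases "m i 0")
    \<comment> \<open>With an empty index range there is no offset for
      \<open>hp_index_nth_start\<close>, so the bound comes from monotonicity of the partial
      sums.\<close>
    case 0
    have "hp_start m i \<le> hp_start m r"
      unfolding hp_start_def using that by (intro sum_mono2) auto
    also have "hp_start m r = length (hp_index r m)"
      unfolding hp_start_def hp_index_eq length_labels interv_sum_list_conv_sum_set_nat
      by (simp add: atLeast0LessThan)
    finally show ?thesis
      using 0 by simp
  next
    case (Suc d)
    then show ?thesis
      using hp_index_nth_start(2)[of i r d m] that by simp
  qed
  then show ?thesis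
    unfolding hill_pick_block_def Let_def hp_index_rows[OF assms(1)] hp_index_rows[OF assms(2)]
    using assms by (intro submatrix_intervals) (simp_all add: dim_hill_pick_mat)
qed

lemma hill_pick_mat_eq_assemble_blocks:
  "hill_pick_mat r k m lam t = assemble_blocks r m (hill_pick_block r k m lam t)"
proof (rule eq_matI, goal_cases)
  case (1 u v)
  then have uv: "u < length (hp_index r m)" "v < length (hp_index r m)"
    by (simp_all add: assemble_blocks_def Let_def)
  obtain i a where u: "i < r" "a < m i 0" "u = hp_start m i + a" "hp_index r m ! u = (i, a)"
    using uv(1) by (rule hp_index_cases)
  obtain j b where v: "j < r" "b < m j 0" "v = hp_start m j + b" "hp_index r m ! v = (j, b)"
    using uv(2) by (rule hp_index_cases)
  have "assemble_blocks r m (hill_pick_block r k m lam t) $$ (u, v)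
      = hill_pick_block r k m lam t i j $$ (a, b)"
    using uv u(4) v(4) by (simp add: assemble_blocks_def Let_def)
  then show ?case
    using u v by (simp add: hill_pick_block_eq)
qed (simp_all add: assemble_blocks_def dim_hill_pick_mat Let_def)

text \<open>\<open>G\<close> is \<open>H\<close> moved along the injection \<open>h\<close> and
  padded with zeros, so the form of \<open>G\<close> at \<open>f\<close> depends only on
  \<open>f\<close> composed with \<open>h\<close>.\<close>

lemma psd_mat_reindex:
  assumes G: "G \<in> carrier_mat n n" and H: "H \<in> carrier_mat w w"
    and h: "inj_on h {..<w}" "h ` {..<w} \<subseteq> {..<n}"
    and entries: "\<And>u v. u < w \<Longrightarrow> v < w \<Longrightarrow> H $$ (u, v) = G $$ (h u, h v)"
    and zero: "\<And>x y. x < n \<Longrightarrow> y < n \<Longrightarrow> x \<notin> h ` {..<w} \<or> y \<notin> h ` {..<w} \<Longrightarrow> G $$ (x, y) = 0"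
  shows "psd_mat G \<longleftrightarrow> psd_mat H"
proof -
  have form: "hform n G f f = hform w H (\<lambda>u. f (h u)) (\<lambda>u. f (h u))" for f
  proof -
    have "hform n G f f = (\<Sum>x\<in>h ` {..<w}. \<Sum>y<n. cnj (f x) * G $$ (x, y) * f y)"
      unfolding hform_def using h(2) zero by (intro sum.mono_neutral_right) auto
    also have "\<dots> = (\<Sum>x\<in>h ` {..<w}. \<Sum>y\<in>h ` {..<w}. cnj (f x) * G $$ (x, y) * f y)"
      using h(2) zero by (intro sum.cong refl sum.mono_neutral_right) auto
    also have "\<dots> = hform w H (\<lambda>u. f (h u)) (\<lambda>u. f (h u))"
      unfolding hform_def using h(1) by (simp add: sum.reindex entries)
    finally show ?thesis .
  qed
  have "(\<forall>f. 0 \<le> hform n G f f) \<longleftrightarrow> (\<forall>f. 0 \<le> hform w H f f)"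
  proof (intro iffI allI)
    fix f assume *: "\<forall>f. 0 \<le> hform n G f f"
    \<comment> \<open>Every test function on the small index set arises from a large one, namely by
      composing with the inverse of \<open>h\<close>.\<close>
    have "hform w H (\<lambda>u. f (inv_into {..<w} h (h u))) (\<lambda>u. f (inv_into {..<w} h (h u))) = hform w H f f"
      unfolding hform_def using h(1) by (intro sum.cong refl) simp
    then show "0 \<le> hform w H f f"
      using * form[of "\<lambda>x. f (inv_into {..<w} h x)"] by metis
  qed (simp add: form)
  moreover have "(\<forall>x<n. \<forall>y<n. G $$ (x, y) = cnj (G $$ (y, x)))
      \<longleftrightarrow> (\<forall>u<w. \<forall>v<w. H $$ (u, v) = cnj (H $$ (v, u)))"
  proof (intro iffI allI impI)
    fix u v assume "\<forall>x<n. \<forall>y<n. G $$ (x, y) = cnj (G $$ (y, x))" "u < w" "v < w"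
    moreover from this have "h u < n" "h v < n"
      using h(2) by auto
    ultimately show "H $$ (u, v) = cnj (H $$ (v, u))"
      unfolding entries[OF \<open>u < w\<close> \<open>v < w\<close>] entries[OF \<open>v < w\<close> \<open>u < w\<close>] by blast
  next
    fix x y assume *: "\<forall>u<w. \<forall>v<w. H $$ (u, v) = cnj (H $$ (v, u))" and xy: "x < n" "y < n"
    show "G $$ (x, y) = cnj (G $$ (y, x))"
    proof (cases "x \<in> h ` {..<w} \<and> y \<in> h ` {..<w}")
      case True
      then obtain u v where "u < w" "v < w" "x = h u" "y = h v"
        by auto
      then show ?thesis
        using *[rule_format, of u v] entries by metis
    next
      case False
      then have "G $$ (x, y) = 0" "G $$ (y, x) = 0"
        using zero xy by blast+
      then show ?thesis
        by simp
    qed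
  qed
  ultimately show ?thesis
    unfolding psd_mat_iff_hform[OF G] psd_mat_iff_hform[OF H] by blast
qed

section \<open>Identification of the kernel formula with the Hill-Pick matrix\<close>

context jordan_data
begin

text \<open>In vectorized form the entry lies in the column of the matrix unit at the block starts
  of \<open>i\<close> and \<open>j\<close>, and its row is position (\<open>?pi + a\<close>,
  \<open>?pj + b\<close>) of the image. The preimage of that unit under \<open>lyap J\<close> is
  \<open>hp_sol\<close> with the indicator weight.\<close>

lemma hill_pick_mat_index:
  assumes ij: "i < r" "j < r" and ab: "a < m i 0" "b < m j 0"
  shows "hill_pick_mat r k m lam t $$ (hp_start m i + a, hp_start m j + b) = hp_coeff lam t j b i a"
proof -
  let ?F = "\<lambda>i' j'. if i' = i \<and> j' = j then 1 else 0 :: complex"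
  have "m i 0 > 0" "m j 0 > 0"
    using ab by auto
  note si = label_start[OF ij(1) \<open>m i 0 > 0\<close>, unfolded add_0_right]
    and sj = label_start[OF ij(2) \<open>m j 0 > 0\<close>, unfolded add_0_right]
    and sa = label_start[OF ij(1) ab(1)] and sb = label_start[OF ij(2) ab(2)]
  let ?pi = "block_start k m i" and ?pj = "block_start k m j"
  have sol: "lyap J (hp_sol ?F) = mat N N (\<lambda>(x, y). if x = ?pi \<and> y = ?pj then 1 else 0)"
  proof (rule eq_matI, goal_cases)
    case (1 x y)
    then have xy: "x < N" "y < N" by simp_all
    have "x = ?pi \<longleftrightarrow> eig x = i \<and> blk x = 0 \<and> pos x = 0"
      using si label_inj[OF xy(1) si(1)] by metis
    moreover have "y = ?pj \<longleftrightarrow> eig y = j \<and> blk y = 0 \<and> pos y = 0"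
      using sj label_inj[OF xy(2) sj(1)] by metis
    ultimately show ?case
      using xy by (simp add: lyap_J_hp_sol)
  qed (simp_all add: lyap_J_hp_sol)
  have "hill_pick_mat r k m lam t $$ (hp_start m i + a, hp_start m j + b)
      = L_mat J (T t) $$ ((?pj + b) * N + (?pi + a), ?pj * N + ?pi)"
    using hp_index_nth_start[of i r a m] hp_index_nth_start[of j r b m] ij ab sa(1) si(1)
      carrier_matD[OF J_carrier]
    by (simp add: hill_pick_mat_def nth_block_def Let_def)
  also have "\<dots> = lyap (T t) (hp_sol ?F) $$ (?pi + a, ?pj + b)"
    by (rule L_mat_index[OF J_carrier T_carrier hp_sol_carrier lyap_J_zero sol sa(1) sb(1) si(1) sj(1)])
  also have "\<dots> = hp_coeff lam t j b i a"
    unfolding lyap_T_hp_sol using sa sb by (simp add: hp_img_def)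
  finally show ?thesis .
qed

text \<open>\<open>hp_img\<close> vanishes outside the blocks with \<open>q = 0\<close>, and on them
  the map \<open>?h\<close> from index pairs to positions matches it with the Hill-Pick
  matrix.\<close>

lemma psd_hill_pick_mat:
  "psd_mat (hp_img t (\<lambda>i j. 1)) \<longleftrightarrow> psd_mat (hill_pick_mat r k m lam t)"
proof (rule psd_mat_reindex[OF hp_img_carrier])
  let ?ix = "hp_index r m"
  let ?h = "\<lambda>u. block_start k m (fst (?ix ! u)) + snd (?ix ! u)"
  have h: "?h u < N \<and> eig (?h u) = fst (?ix ! u) \<and> blk (?h u) = 0 \<and> pos (?h u) = snd (?ix ! u)"
    if "u < length ?ix" for u
    using that label_start by (auto elim!: hp_index_cases)
  show "hill_pick_mat r k m lam t \<in> carrier_mat (length ?ix) (length ?ix)"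
    by (rule carrier_matI) (simp_all add: dim_hill_pick_mat)
  show "?h ` {..<length ?ix} \<subseteq> {..<N}"
    using h by auto
  have "distinct ?ix"
    unfolding hp_index_eq by (simp add: distinct_labels)
  show "inj_on ?h {..<length ?ix}"
  proof (rule inj_onI)
    fix u v assume uv: "u \<in> {..<length ?ix}" "v \<in> {..<length ?ix}" "?h u = ?h v"
    note hu = h[OF uv(1)[unfolded lessThan_iff], unfolded uv(3)]
      and hv = h[OF uv(2)[unfolded lessThan_iff]]
    have "fst (?ix ! u) = fst (?ix ! v)" "snd (?ix ! u) = snd (?ix ! v)"
      using hu hv by metis+
    then have "?ix ! u = ?ix ! v"
      by (rule prod_eqI)
    then show "u = v"
      using uv nth_eq_iff_index_eq[OF \<open>distinct ?ix\<close>] by simp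
  qed
  show "hill_pick_mat r k m lam t $$ (u, v) = hp_img t (\<lambda>i j. 1) $$ (?h u, ?h v)"
    if uv: "u < length ?ix" "v < length ?ix" for u v
  proof -
    obtain i a where u: "i < r" "a < m i 0" "u = hp_start m i + a" "?ix ! u = (i, a)"
      using uv(1) by (rule hp_index_cases)
    obtain j b where v: "j < r" "b < m j 0" "v = hp_start m j + b" "?ix ! v = (j, b)"
      using uv(2) by (rule hp_index_cases)
    have "hill_pick_mat r k m lam t $$ (u, v) = hp_coeff lam t j b i a"
      using hill_pick_mat_index u v by simp
    then show ?thesis
      using h[OF uv(1)] h[OF uv(2)] u(4) v(4) by (simp add: hp_img_def)
  qed
  have in_range: "x \<in> ?h ` {..<length ?ix}" if "x < N" "blk x = 0" for x
  proof -
    note b = label_bounds[OF that(1), unfolded that(2)]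
    note p = hp_index_nth_start[of "eig x" r "pos x" m, OF b(1,3)]
    have "x = block_start k m (eig x) + pos x"
      by (rule label_inj) (use label_start[OF b(1,3)] that in simp_all)
    then have "x = ?h (hp_start m (eig x) + pos x)"
      by (simp add: p)
    then show ?thesis
      using p(2) by blast
  qed
  show "hp_img t (\<lambda>i j. 1) $$ (x, y) = 0"
    if "x < N" "y < N" "x \<notin> ?h ` {..<length ?ix} \<or> y \<notin> ?h ` {..<length ?ix}" for x y
    using that in_range by (auto simp: hp_img_def)
qed

end

section \<open>Transfer from the Jordan form to \<open>A\<close> and \<open>B\<close>\<close>

theorem theorem5p3:
  fixes A B P Q :: "complex mat"
    and n r :: nat
    and k :: "nat \<Rightarrow> nat"
    and m :: "nat \<Rightarrow> nat \<Rightarrow> nat"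
    and lam :: "nat \<Rightarrow> complex"
    and t :: "nat \<Rightarrow> nat \<Rightarrow> complex"
  assumes "A \<in> carrier_mat n n" and "B \<in> carrier_mat n n"
    and "lyapunov_regular A"
    and "B \<in> bicommutant A"
    and "inj_on lam {..<r}" and "lam ` {..<r} = spectrum A"
    and "\<And>j. j < r \<Longrightarrow> 0 < k j"
    and "\<And>j q. j < r \<Longrightarrow> q < k j \<Longrightarrow> 0 < m j q"
    and "\<And>j q q'. j < r \<Longrightarrow> q \<le> q' \<Longrightarrow> q' < k j \<Longrightarrow> m j q' \<le> m j q"
    and "similar_mat_wit A (jordan_form r k m lam) P Q"
    and "similar_mat_wit B (shift_poly_form r k m t) P Q"
  shows "hill_pick_mat r k m lam t = assemble_blocks r m (hill_pick_block r k m lam t)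
    \<and> (\<forall>i<r. \<forall>j<r. hill_pick_block r k m lam t i j
          = mat (m i 0) (m j 0) (\<lambda>(a, b). hp_coeff lam t j b i a))
    \<and> (lyapunov_dominates B A \<longleftrightarrow> psd_mat (hill_pick_mat r k m lam t))"
proof -
  have "eigenvalue A (lam j)" if "j < r" for j
    using that assms(6) unfolding spectrum_def by blast
  \<comment> \<open>Each lam j is an eigenvalue of \<open>A\<close>, so Lyapunov regularity gives
    \<open>regular\<close>; the ordering of the block sizes, taken from block 0, gives
    \<open>m_le\<close>.\<close>
  then interpret jordan_data r k m lam
    using assms(3,7,9) by unfold_locales (auto simp: lyapunov_regular_def)
  have "hill_pick_block r k m lam t i j = mat (m i 0) (m j 0) (\<lambda>(a, b). hp_coeff lam t j b i a)"
    if "i < r" "j < r" for i j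
    unfolding hill_pick_block_eq[OF that]
    by (rule eq_matI) (simp_all add: hill_pick_mat_index that)
  moreover have "lyapunov_dominates B A \<longleftrightarrow> psd_mat (hill_pick_mat r k m lam t)"
  proof -
    note simA = assms(10) and simB = assms(11)
    have "lyapunov_dominates B A \<longleftrightarrow> lyapunov_dominates (T t) J"
      using lyapunov_dominates_similar[OF assms(1,2) simA simB]
        lyapunov_dominates_similar[OF similar_mat_witD2(5)[OF assms(1) simA]
          similar_mat_witD2(5)[OF assms(2) simB] similar_mat_wit_sym[OF simA]
          similar_mat_wit_sym[OF simB]]
      by blast
    then show ?thesis
      using lyapunov_dominates_iff_hp_img psd_hill_pick_mat by simp
  qed
  ultimately show ?thesis
    using hill_pick_mat_eq_assemble_blocks by blast
qed

end
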